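(* Suppose that $X$ is a complete metric space, $\Gamma\subset\Sigma$ is a compact set satisfying $\sigma(\Gamma)\subset\Gamma$, and $\{E_{\mathtt{i}}:\mathtt{i}\in\Gamma_*\}$ is a Moran construction in $X$ satisfying: (i) there exists $D\ge1$ such that $\operatorname{diam}(E_{\mathtt{i}\mathtt{j}})\le D\operatorname{diam}(E_{\mathtt{i}})\operatorname{diam}(E_{\mathtt{j}})$ for all $\mathtt{i}\mathtt{j}\in\Gamma_*$; (ii) there exists $0<\underline{\alpha}<1$ such that $\operatorname{diam}(E_{\mathtt{i}})\ge\underline{\alpha}\operatorname{diam}(E_{\mathtt{i}^-})$ for all $\mathtt{i}\in\Gamma_*\setminus\{\varnothing\}$. If the Moran construction satisfies the uniform finite clustering property, $E$ is its limit set, and $t\ge0$ is such that $P(t)=0$, then $t=\dim_{\mathrm H}(E)=\dim_{\mathrm A}(E)$ and $\mathcal{H}^t(E)>0$.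
   Context: Shift space: $\kappa\ge2$, $\Sigma=\{1,\ldots,\kappa\}^{\mathbb{N}}$, with the metric in which two distinct words are at distance $2^{-n}$, $n$ being the first place at which they differ; $\sigma$ is the left shift. $\mathtt{i}|_n$ is the word of the first $n$ letters of $\mathtt{i}$, $\mathtt{i}|_0=\varnothing$ is the empty word. For $\Gamma\subset\Sigma$, $\Gamma_n=\{\mathtt{i}|_n:\mathtt{i}\in\Gamma\}$ and $\Gamma_*=\bigcup_{n=0}^\infty\Gamma_n$. $|\mathtt{i}|$ is the length of $\mathtt{i}$ and $\mathtt{i}^-$ is the non-empty finite word $\mathtt{i}$ with last letter removed. Moran construction: a collection $\{E_{\mathtt{i}}:\mathtt{i}\in\Gamma_*\}$ of closed and bounded subsets of $X$ with positive diameter such that $E_{\mathtt{i}}\subset E_{\mathtt{i}^-}$ for all $\mathtt{i}\in\Gamma_*\setminus\{\varnothing\}$ and $\operatorname{diam}(E_{\mathtt{i}|_n})\to0$ as $n\to\infty$ for all $\mathtt{i}\in\Gamma$. The projection $\pi\colon\Gamma\to X$ is defined by $\{\pi(\mathtt{i})\}=\bigcap_{n=1}^\infty E_{\mathtt{i}|_n}$; the limit set is $E=\pi(\Gamma)$. Uniform finite clustering property: $\Gamma(r)=\{\mathtt{i}\in\Gamma_*\setminus\{\varnothing\}:\operatorname{diam}(E_{\mathtt{i}})\le r<\operatorname{diam}(E_{\mathtt{i}^-})\}$, $\Gamma(x,r)=\{\mathtt{i}\in\Gamma(r):E_{\mathtt{i}}\cap B(x,r)\ne\emptyset\}$ with $B(x,r)$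 the closed ball; the property is $\sup_{x\in E}\sup_{r>0}\#\Gamma(x,r)<\infty$. Topological pressure: $P(t)=\lim_{n\to\infty}\frac1n\log\sum_{\mathtt{i}\in\Gamma_n}\operatorname{diam}(E_{\mathtt{i}})^t$ for $t\ge0$ (the limit exists under (i) and (ii)). Dimensions: $\mathcal{H}^t$ is the $t$-dimensional Hausdorff measure and $\dim_{\mathrm H}$ the Hausdorff dimension. The Assouad dimension $\dim_{\mathrm A}(A)$ is the infimum of all $t\ge 0$ for which there is $C\ge1$ such that for all $x \in A$ and $0<r<R$ the set $A\cap B(x,R)$ can be covered by at most $C(r/R)^{-t}$ balls of radius $r$ centered at $A$. *)

theory Defs
  imports "HOL-Analysis.Analysis"
begin

section \<open>Shift space\<close>

text \<open>Infinite words are functions on \<open>nat\<close>, so \<open>i k\<close> is the letter of \<open>i\<close> at the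
  \<open>(k + 1)\<close>-st place; finite words are lists.\<close>

type_synonym word = "nat \<Rightarrow> nat"

definition full_shift :: "nat \<Rightarrow> word set" where
  "full_shift \<kappa> = UNIV \<rightarrow> {1..\<kappa>}"

definition word_dist :: "word \<Rightarrow> word \<Rightarrow> real" where
  "word_dist i j = (if i = j then 0 else (1/2) ^ Suc (LEAST k. i k \<noteq> j k))"

definition left_shift :: "word \<Rightarrow> word" where
  "left_shift i = (\<lambda>k. i (Suc k))"

definition trunc :: "nat \<Rightarrow> word \<Rightarrow> nat list" where
  "trunc n i = map i [0..<n]"

definition words_of_length :: "word set \<Rightarrow> nat \<Rightarrow> nat list set" where
  "words_of_length \<Gamma> n = trunc n ` \<Gamma>"

definition finite_words :: "word set \<Rightarrow> nat list set" where
  "finite_words \<Gamma> = (\<Union>n. words_of_length \<Gamma> n)"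

lemma word_dist_le_iff:
  assumes "i \<noteq> j"
  shows "word_dist i j \<le> (1/2) ^ Suc n \<longleftrightarrow> (\<forall>k<n. i k = j k)"
proof -
  let ?m = "LEAST k. i k \<noteq> j k"
  have ex: "\<exists>k. i k \<noteq> j k" using assms by auto
  have "word_dist i j \<le> (1/2) ^ Suc n \<longleftrightarrow> n \<le> ?m"
    using assms by (simp add: word_dist_def power_decreasing_iff del: power_Suc)
  also have "\<dots> \<longleftrightarrow> (\<forall>k<n. i k = j k)"
    using LeastI_ex[OF ex] not_less_Least[of _ "\<lambda>k. i k \<noteq> j k"]
    by (meson leI order.strict_trans2)
  finally show ?thesis .
qed

lemma word_dist_ultra: "word_dist i l \<le> max (word_dist i j) (word_dist j l)"
proof (cases "i = j \<or> j = l \<or> i = l")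
  case True
  then show ?thesis by (auto simp: word_dist_def le_max_iff_disj)
next
  case False
  define a where "a = (LEAST k. i k \<noteq> j k)"
  define b where "b = (LEAST k. j k \<noteq> l k)"
  have d: "word_dist i j = (1/2) ^ Suc a" "word_dist j l = (1/2) ^ Suc b"
    using False by (auto simp: word_dist_def a_def b_def)
  have "\<forall>k<a. i k = j k" "\<forall>k<b. j k = l k"
    using word_dist_le_iff[of i j a] word_dist_le_iff[of j l b] False d by auto
  then have "word_dist i l \<le> (1/2) ^ Suc (min a b)"
    using word_dist_le_iff[of i l "min a b"] False by auto
  then show ?thesis unfolding d by (auto simp: min_def max_def split: if_splits)
qed

lemma Metric_space_word_dist: "Metric_space (full_shift \<kappa>) word_dist"
proof
  show nonneg: "0 \<le> word_dist i j" for i j by (simp add: word_dist_def)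
  show "word_dist i j = word_dist j i" for i j
    unfolding word_dist_def by (auto simp: eq_commute)
  show "word_dist i j = 0 \<longleftrightarrow> i = j" for i j by (simp add: word_dist_def)
  show "word_dist i l \<le> word_dist i j + word_dist j l" for i j l
    using word_dist_ultra[of i l j] nonneg[of i j] nonneg[of j l] by linarith
qed


section \<open>Moran constructions\<close>

text \<open>\<open>butlast i\<close> is the word \<open>i\<close> with its last letter removed.\<close>

definition moran_construction :: "word set \<Rightarrow> (nat list \<Rightarrow> 'a::metric_space set) \<Rightarrow> bool" where
  "moran_construction \<Gamma> E \<longleftrightarrow>
     (\<forall>i \<in> finite_words \<Gamma>. closed (E i) \<and> bounded (E i) \<and> diameter (E i) > 0) \<and>
     (\<forall>i \<in> finite_words \<Gamma> - {[]}. E i \<subseteq> E (butlast i)) \<and>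
     (\<forall>i \<in> \<Gamma>. (\<lambda>n. diameter (E (trunc n i))) \<longlonglongrightarrow> 0)"

definition moran_proj :: "(nat list \<Rightarrow> 'a set) \<Rightarrow> word \<Rightarrow> 'a" where
  "moran_proj E i = the_elem (\<Inter>n\<in>{1..}. E (trunc n i))"

definition limit_set :: "word set \<Rightarrow> (nat list \<Rightarrow> 'a set) \<Rightarrow> 'a set" where
  "limit_set \<Gamma> E = moran_proj E ` \<Gamma>"

definition cut_set :: "word set \<Rightarrow> (nat list \<Rightarrow> 'a::metric_space set) \<Rightarrow> real \<Rightarrow> nat list set" where
  "cut_set \<Gamma> E r =
     {i \<in> finite_words \<Gamma> - {[]}. diameter (E i) \<le> r \<and> r < diameter (E (butlast i))}"

definition local_cut_set ::
    "word set \<Rightarrow> (nat list \<Rightarrow> 'a::metric_space set) \<Rightarrow> 'a \<Rightarrow> real \<Rightarrow> nat list set" where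
  "local_cut_set \<Gamma> E x r = {i \<in> cut_set \<Gamma> E r. E i \<inter> cball x r \<noteq> {}}"

text \<open>Finiteness is required separately, because \<open>card\<close> of an infinite set is \<open>0\<close>.\<close>

definition uniform_finite_clustering ::
    "word set \<Rightarrow> (nat list \<Rightarrow> 'a::metric_space set) \<Rightarrow> bool" where
  "uniform_finite_clustering \<Gamma> E \<longleftrightarrow>
     (\<exists>N. \<forall>x \<in> limit_set \<Gamma> E. \<forall>r>0.
        finite (local_cut_set \<Gamma> E x r) \<and> card (local_cut_set \<Gamma> E x r) \<le> N)"

text \<open>The convention \<open>log 0 = -\<infinity>\<close> only matters for empty \<open>\<Gamma>\<close>, where the partition sums
  vanish: the pressure is then \<open>-\<infinity>\<close>, and not \<open>0\<close> as it would be with \<open>ln 0 = 0\<close>.\<close>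

definition ext_log :: "real \<Rightarrow> ereal" where
  "ext_log x = (if x = 0 then -\<infinity> else ereal (ln x))"

definition pressure ::
    "word set \<Rightarrow> (nat list \<Rightarrow> 'a::metric_space set) \<Rightarrow> real \<Rightarrow> ereal" where
  "pressure \<Gamma> E t =
     lim (\<lambda>n. ereal (1 / real n) *
              ext_log (\<Sum>i\<in>words_of_length \<Gamma> n. diameter (E i) powr t))"


section \<open>Hausdorff measure and dimensions\<close>

text \<open>\<open>diam(U)\<^sup>t\<close> with the usual conventions: the empty set contributes \<open>0\<close> for every \<open>t\<close>,
  while \<open>0\<^sup>0 = 1\<close> for non-empty sets, so that the measure for \<open>t = 0\<close> is the counting measure.
  (In HOL, \<open>0 powr 0 = 0\<close>.)\<close>

definition hausdorff_gauge :: "real \<Rightarrow> 'a::metric_space set \<Rightarrow> ennreal" where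
  "hausdorff_gauge t U =
     (if U = {} then 0 else if t = 0 then 1 else ennreal (diameter U powr t))"

text \<open>Covering sets are required to be bounded because \<open>diameter\<close> is only meaningful for
  bounded sets.\<close>

definition hausdorff_premeasure :: "real \<Rightarrow> real \<Rightarrow> 'a::metric_space set \<Rightarrow> ennreal" where
  "hausdorff_premeasure t \<delta> A =
     (INF U \<in> {U :: nat \<Rightarrow> 'a set. A \<subseteq> (\<Union>n. U n) \<and>
                 (\<forall>n. bounded (U n) \<and> diameter (U n) \<le> \<delta>)}.
        \<Sum>n. hausdorff_gauge t (U n))"

definition hausdorff_measure :: "real \<Rightarrow> 'a::metric_space set \<Rightarrow> ennreal" where
  "hausdorff_measure t A = (SUP \<delta>\<in>{0<..}. hausdorff_premeasure t \<delta> A)"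

definition hausdorff_dim :: "'a::metric_space set \<Rightarrow> ereal" where
  "hausdorff_dim A = Inf {ereal t | t. 0 \<le> t \<and> hausdorff_measure t A = 0}"

definition assouad_dim :: "'a::metric_space set \<Rightarrow> ereal" where
  "assouad_dim A = Inf {ereal t | t. 0 \<le> t \<and>
     (\<exists>C\<ge>1. \<forall>x\<in>A. \<forall>r R. 0 < r \<and> r < R \<longrightarrow>
        (\<exists>F\<subseteq>A. finite F \<and> real (card F) \<le> C * (r / R) powr (- t) \<and>
               A \<inter> cball x R \<subseteq> (\<Union>y\<in>F. cball y r)))}"

end

theory Submission
  imports Defs
begin

text \<open>The sets \<open>E i\<close> have diameters that are submultiplicative in \<open>i\<close> up to the factor \<open>D\<close>, so the
  weights \<open>(D * diam i) powr t\<close> are submultiplicative, and so are their sums over the words of length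
  \<open>n\<close>, because prefixes and suffixes of words of \<open>\<Gamma>\<close> are again words of \<open>\<Gamma>\<close>.  Fekete's lemma
  (\<open>subadditive_quotient_tendsto_Inf\<close>) then says that zero pressure has two consequences
  (\<open>partition_sum_bounds\<close>): these sums are at least \<open>1\<close> for \<open>n > 0\<close>, and they
  grow subexponentially.  Each consequence yields one of the two dimension bounds.

  \<^emph>\<open>Upper bound for the Assouad dimension.\<close>  Compactness of \<open>\<Gamma>\<close> makes the pointwise convergence
  of diameters to \<open>0\<close> uniform, and submultiplicativity turns this into exponential decay in the
  length of the word.  Hence \<open>diam i powr s\<close> has a finite sum over all words as soon as \<open>s > t\<close>, so
  at most \<open>O(\<rho> powr - s)\<close> words have diameter at least \<open>\<rho>\<close>.  To cover the limit set near a point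
  at scale \<open>r\<close>, start from the boundedly many words of scale \<open>R\<close> that clustering permits there and
  extend each of them to words of scale \<open>r\<close>.  Since diameters shrink at most by the factor \<open>\<alpha>\<close>
  with each letter, the extended words have diameter about \<open>r\<close>, so the extending words \<open>j\<close> have
  \<open>diam j\<close> at least about \<open>r / R\<close> and there are \<open>O((r / R) powr - s)\<close> of them
  (\<open>assouad_dim_le\<close>).

  \<^emph>\<open>Positivity of the Hausdorff measure.\<close>  Let a finite set of words contain a prefix of every
  element of \<open>\<Gamma>\<close>.  If its weights had sum below \<open>1\<close>, then writing long words as concatenations of
  members of the set would show that the sums over the words of length \<open>n\<close> tend to \<open>0\<close>
  (\<open>sum_words_tendsto_0\<close>), which zero pressure forbids.  By clustering, a cover of the limit set
  by arbitrary small sets yields a cover by words of comparable total size, and by compactness a finite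
  one, so that this total size is bounded from below (\<open>hausdorff_premeasure_ge\<close>).

  The two bounds close up, because positive Hausdorff measure gives \<open>t \<le> hausdorff_dim\<close>, and the
  Hausdorff dimension of a bounded set is at most its Assouad dimension.\<close>


section \<open>Subadditive sequences\<close>

text \<open>Fekete's lemma.  For a fixed \<open>m\<close>, division with remainder \<open>n = q m + r\<close> gives
  \<open>a n \<le> q a m + a r\<close>, and the part of the right-hand side that is not proportional to \<open>n\<close>
  is bounded.  So the limsup of \<open>a n / n\<close> is at most \<open>a m / m\<close> for every \<open>m\<close>.\<close>

lemma subadditive_quotient_tendsto_Inf:
  fixes a :: "nat \<Rightarrow> real"
  assumes sub: "\<And>m n. a (m + n) \<le> a m + a n"
    and bdd: "\<And>n. n > 0 \<Longrightarrow> c \<le> a n / real n"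
  obtains L where "(\<lambda>n. a n / real n) \<longlonglongrightarrow> L" "\<And>n. n > 0 \<Longrightarrow> L \<le> a n / real n"
proof -
  define L where "L = Inf ((\<lambda>n. a n / real n) ` {0<..})"
  have bb: "bdd_below ((\<lambda>n. a n / real n) ` {0<..})"
    using bdd by (auto intro!: bdd_belowI)
  have L_le: "L \<le> a n / real n" if "n > 0" for n
    unfolding L_def using that by (intro cINF_lower bb) auto
  have mult: "a (q * m + r) \<le> real q * a m + a r" for q m r
  proof (induction q)
    case (Suc q)
    have "a (Suc q * m + r) \<le> a m + a (q * m + r)"
      using sub[of m "q * m + r"] by (simp only: mult_Suc add.assoc)
    also have "\<dots> \<le> a m + (real q * a m + a r)"
      using Suc by simp
    also have "\<dots> = real (Suc q) * a m + a r"
      by (simp add: distrib_right)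
    finally show ?case .
  qed simp
  have "(\<lambda>n. a n / real n) \<longlonglongrightarrow> L"
  proof (rule order_tendstoI)
    fix y assume "y < L"
    show "\<forall>\<^sub>F n in sequentially. y < a n / real n"
      using eventually_gt_at_top[of 0] by eventually_elim (rule less_le_trans[OF \<open>y < L\<close> L_le])
  next
    fix y assume "L < y"
    then obtain m where m: "m > 0" "a m / real m < y"
      unfolding L_def by (subst (asm) cINF_less_iff[OF _ bb]) auto
    define B where "B = \<bar>a m\<bar> + (\<Sum>r<m. \<bar>a r\<bar>)"
    have upper: "a n / real n \<le> a m / real m + B / real n" if n: "n > 0" for n
    proof -
      define q where "q = n div m"
      define r where "r = n mod m"
      have n_eq: "n = q * m + r" and r: "r < m" using m by (auto simp: q_def r_def)
      have q: "real q = real n / real m - real r / real m"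
        using arg_cong[OF n_eq, of real] m by (simp add: diff_divide_distrib[symmetric])
      have "real r / real m * (- a m) \<le> 1 * \<bar>a m\<bar>"
        using r by (intro order_trans[OF mult_left_mono[of "- a m" "\<bar>a m\<bar>"] mult_right_mono]) auto
      moreover have "a r \<le> (\<Sum>r<m. \<bar>a r\<bar>)"
        using r member_le_sum[of r "{..<m}" "\<lambda>r. \<bar>a r\<bar>"] by auto
      moreover have "real q * a m = real n * (a m / real m) + real r / real m * (- a m)"
        unfolding q by (simp add: left_diff_distrib)
      ultimately have "real q * a m + a r \<le> real n * (a m / real m) + B"
        unfolding B_def by linarith
      then have "a n \<le> real n * (a m / real m) + B"
        using mult[of q m r] n_eq by (metis order_trans)
      then have "a n / real n \<le> (real n * (a m / real m) + B) / real n"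
        by (intro divide_right_mono) auto
      also have "\<dots> = a m / real m + B / real n" using n by (simp add: add_divide_distrib)
      finally show ?thesis .
    qed
    have "(\<lambda>n. a m / real m + B / real n) \<longlonglongrightarrow> a m / real m + 0"
      by (intro tendsto_intros lim_const_over_n)
    then have "\<forall>\<^sub>F n in sequentially. a m / real m + B / real n < y"
      using m by (intro order_tendstoD) auto
    then show "\<forall>\<^sub>F n in sequentially. a n / real n < y"
      using eventually_gt_at_top[of 0] by eventually_elim (rule le_less_trans[OF upper])
  qed
  with L_le show ?thesis using that by blast
qed


section \<open>Words of a shift-invariant set\<close>

lemma length_trunc [simp]: "length (trunc n k) = n"
  by (simp add: trunc_def)

lemma trunc_0 [simp]: "trunc 0 k = []"
  by (simp add: trunc_def)

lemma trunc_eq_Nil_iff [simp]: "trunc n k = [] \<longleftrightarrow> n = 0"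
  by (simp add: trunc_def)

lemma butlast_trunc_Suc [simp]: "butlast (trunc (Suc n) k) = trunc n k"
  by (simp add: trunc_def)

lemma trunc_eq_iff: "trunc n j = trunc n k \<longleftrightarrow> (\<forall>l<n. j l = k l)"
  by (auto simp: trunc_def)

lemma trunc_add: "trunc (m + n) k = trunc m k @ trunc n ((left_shift ^^ m) k)"
proof -
  have "(left_shift ^^ m) k l = k (m + l)" for l
    by (induction m arbitrary: l) (simp_all add: left_shift_def)
  then show ?thesis
    by (auto simp: trunc_def nth_append intro!: nth_equalityI)
qed

lemma funpow_left_shift_mem:
  "left_shift ` \<Gamma> \<subseteq> \<Gamma> \<Longrightarrow> k \<in> \<Gamma> \<Longrightarrow> (left_shift ^^ m) k \<in> \<Gamma>"
  by (induction m) auto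

lemma trunc_mem_words_of_length [intro]: "k \<in> \<Gamma> \<Longrightarrow> trunc n k \<in> words_of_length \<Gamma> n"
  by (auto simp: words_of_length_def)

lemma trunc_mem_finite_words [intro]: "k \<in> \<Gamma> \<Longrightarrow> trunc n k \<in> finite_words \<Gamma>"
  by (auto simp: finite_words_def)

lemma words_of_length_subset: "words_of_length \<Gamma> n \<subseteq> finite_words \<Gamma>"
  by (auto simp: finite_words_def)

lemma length_words_of_length: "i \<in> words_of_length \<Gamma> n \<Longrightarrow> length i = n"
  by (auto simp: words_of_length_def)

lemma mem_words_of_length_length: "i \<in> finite_words \<Gamma> \<Longrightarrow> i \<in> words_of_length \<Gamma> (length i)"
  by (auto simp: finite_words_def words_of_length_def)

lemma finite_wordsE:
  assumes "i \<in> finite_words \<Gamma>"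
  obtains k where "k \<in> \<Gamma>" "i = trunc (length i) k"
  using assms by (auto simp: finite_words_def words_of_length_def)

lemma finite_words_of_length:
  assumes "\<Gamma> \<subseteq> full_shift \<kappa>"
  shows "finite (words_of_length \<Gamma> n)"
proof (rule finite_subset)
  show "words_of_length \<Gamma> n \<subseteq> {xs. set xs \<subseteq> {1..\<kappa>} \<and> length xs = n}"
    using assms by (fastforce simp: words_of_length_def trunc_def full_shift_def Pi_def)
  show "finite {xs. set xs \<subseteq> {1..\<kappa>} \<and> length xs = n}"
    by (rule finite_lists_length_eq) simp
qed

lemma finite_words_appendD:
  assumes "left_shift ` \<Gamma> \<subseteq> \<Gamma>" "i @ j \<in> finite_words \<Gamma>"
  shows "i \<in> finite_words \<Gamma>" "j \<in> finite_words \<Gamma>"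
proof -
  obtain k where k: "k \<in> \<Gamma>" "i @ j = trunc (length i + length j) k"
    using assms(2) by (auto elim: finite_wordsE)
  then have "i = trunc (length i) k" "j = trunc (length j) ((left_shift ^^ length i) k)"
    by (auto simp: trunc_add)
  with k(1) assms(1) show "i \<in> finite_words \<Gamma>" "j \<in> finite_words \<Gamma>"
    by (metis funpow_left_shift_mem trunc_mem_finite_words)+
qed

text \<open>The words that agree with \<open>k\<close> on the first \<open>n\<close> letters form an open ball, so compactness of
  \<open>\<Gamma>\<close> extracts a finite family from any family of words that contains a prefix of every
  element of \<open>\<Gamma>\<close>.\<close>

lemma mem_mball_word_dist_iff:
  assumes "j \<in> full_shift \<kappa>" "k \<in> full_shift \<kappa>"
  shows "j \<in> Metric_space.mball (full_shift \<kappa>) word_dist k ((1/2) ^ n) \<longleftrightarrow> trunc n j = trunc n k"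
proof -
  interpret Metric_space "full_shift \<kappa>" word_dist by (rule Metric_space_word_dist)
  have "word_dist k j < (1/2) ^ n \<longleftrightarrow> (\<forall>l<n. j l = k l)"
  proof (cases "k = j")
    case False
    have "word_dist k j < (1/2) ^ n \<longleftrightarrow> word_dist k j \<le> (1/2) ^ Suc n"
      using False by (simp add: word_dist_def power_strict_decreasing_iff power_decreasing_iff
          less_Suc_eq_le del: power_Suc)
    then show ?thesis using word_dist_le_iff[OF False, of n] by (auto simp: eq_commute)
  qed (simp add: word_dist_def)
  then show ?thesis using assms by (simp add: trunc_eq_iff)
qed

lemma finite_prefix_subcover:
  assumes "\<Gamma> \<subseteq> full_shift \<kappa>"
    and "compactin (Metric_space.mtopology (full_shift \<kappa>) word_dist) \<Gamma>"
    and "\<And>k. k \<in> \<Gamma> \<Longrightarrow> \<exists>m. trunc m k \<in> F"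
  obtains F' where "finite F'" "F' \<subseteq> F" "\<And>k. k \<in> \<Gamma> \<Longrightarrow> \<exists>m. trunc m k \<in> F'"
proof -
  interpret Metric_space "full_shift \<kappa>" word_dist by (rule Metric_space_word_dist)
  obtain m where m: "\<And>k. k \<in> \<Gamma> \<Longrightarrow> trunc (m k) k \<in> F"
    using assms(3) by metis
  define \<U> where "\<U> = (\<lambda>k. mball k ((1/2) ^ m k)) ` \<Gamma>"
  have "\<forall>T\<in>\<U>. openin mtopology T" by (auto simp: \<U>_def)
  moreover have "\<Gamma> \<subseteq> \<Union>\<U>"
  proof
    fix k assume "k \<in> \<Gamma>"
    then have "k \<in> mball k ((1/2) ^ m k)" using assms(1) by auto
    then show "k \<in> \<Union>\<U>" using \<open>k \<in> \<Gamma>\<close> by (auto simp: \<U>_def)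
  qed
  ultimately obtain \<V> where \<V>: "finite \<V>" "\<V> \<subseteq> \<U>" "\<Gamma> \<subseteq> \<Union>\<V>"
    using assms(2) unfolding compactin_def by meson
  then obtain K where K: "K \<subseteq> \<Gamma>" "finite K" "\<V> = (\<lambda>k. mball k ((1/2) ^ m k)) ` K"
    unfolding \<U>_def by (meson finite_subset_image)
  show ?thesis
  proof
    show "finite ((\<lambda>k. trunc (m k) k) ` K)" using K by auto
    show "(\<lambda>k. trunc (m k) k) ` K \<subseteq> F" using K m by auto
    show "\<exists>l. trunc l j \<in> (\<lambda>k. trunc (m k) k) ` K" if j: "j \<in> \<Gamma>" for j
    proof -
      obtain k where k: "k \<in> K" "j \<in> mball k ((1/2) ^ m k)" using \<V>(3) j K(3) by auto
      then have "trunc (m k) j = trunc (m k) k"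
        using mem_mball_word_dist_iff[of j \<kappa> k "m k"] j K(1) assms(1) by blast
      with k(1) show ?thesis by (intro exI[of _ "m k"]) auto
    qed
  qed
qed


section \<open>Sums of submultiplicative weights\<close>

text \<open>Every word of length \<open>n\<close> splits into a prefix from \<open>F\<close> and a remainder, which is again a
  word of \<open>\<Gamma>\<close> by shift-invariance.\<close>

lemma sum_words_le_sum_prefixes:
  fixes w :: "nat list \<Rightarrow> real"
  assumes sub: "\<Gamma> \<subseteq> full_shift \<kappa>" and shift: "left_shift ` \<Gamma> \<subseteq> \<Gamma>"
    and nonneg: "\<And>i. 0 \<le> w i"
    and submult: "\<And>i j. i @ j \<in> finite_words \<Gamma> \<Longrightarrow> w (i @ j) \<le> w i * w j"
    and "finite F" and cover: "\<And>k. k \<in> \<Gamma> \<Longrightarrow> \<exists>m\<le>n. trunc m k \<in> F"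
  shows "sum w (words_of_length \<Gamma> n) \<le>
    (\<Sum>f\<in>F. w f * sum w (words_of_length \<Gamma> (n - length f)))"
proof -
  define S where "S = Sigma F (\<lambda>f. words_of_length \<Gamma> (n - length f))"
  define P where "P = {p \<in> S. fst p @ snd p \<in> words_of_length \<Gamma> n}"
  have fin: "finite S" unfolding S_def using \<open>finite F\<close> finite_words_of_length[OF sub] by auto
  then have finP: "finite P" by (simp add: P_def)
  have "words_of_length \<Gamma> n \<subseteq> (\<lambda>p. fst p @ snd p) ` P"
  proof
    fix u assume u: "u \<in> words_of_length \<Gamma> n"
    then obtain k where k: "k \<in> \<Gamma>" "u = trunc n k" by (auto simp: words_of_length_def)
    then obtain m where m: "m \<le> n" "trunc m k \<in> F" using cover by blast
    define v where "v = trunc (n - m) ((left_shift ^^ m) k)"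
    have "u = trunc m k @ v" using trunc_add[of m "n - m" k] m k by (simp add: v_def)
    moreover have "v \<in> words_of_length \<Gamma> (n - m)"
      unfolding v_def using funpow_left_shift_mem[OF shift k(1)] by auto
    ultimately have "(trunc m k, v) \<in> P" "u = fst (trunc m k, v) @ snd (trunc m k, v)"
      using m u by (auto simp: P_def S_def)
    then show "u \<in> (\<lambda>p. fst p @ snd p) ` P" by blast
  qed
  then have "sum w (words_of_length \<Gamma> n) \<le> sum w ((\<lambda>p. fst p @ snd p) ` P)"
    using finP nonneg by (intro sum_mono2) auto
  also have "\<dots> \<le> sum (w \<circ> (\<lambda>p. fst p @ snd p)) P"
    using finP nonneg by (intro sum_image_le) auto
  also have "\<dots> \<le> (\<Sum>p\<in>P. w (fst p) * w (snd p))"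
    unfolding o_def using words_of_length_subset
    by (intro sum_mono submult) (auto simp: P_def)
  also have "\<dots> \<le> (\<Sum>p\<in>S. w (fst p) * w (snd p))"
    using fin nonneg by (intro sum_mono2) (auto simp: P_def)
  also have "\<dots> = (\<Sum>f\<in>F. w f * sum w (words_of_length \<Gamma> (n - length f)))"
    unfolding S_def using \<open>finite F\<close> finite_words_of_length[OF sub]
    by (simp add: sum.Sigma sum_distrib_left case_prod_unfold)
  finally show ?thesis .
qed

text \<open>Cutting off prefixes from \<open>F\<close> repeatedly writes a word of length \<open>n\<close> as a product of at
  least about \<open>n / M\<close> elements of \<open>F\<close>, where \<open>M\<close> bounds their lengths, and a short remainder.
  Each factor contributes at most \<open>sum w F < 1\<close>, so the sums decay exponentially.\<close>

lemma sum_words_tendsto_0: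
  fixes w :: "nat list \<Rightarrow> real"
  assumes sub: "\<Gamma> \<subseteq> full_shift \<kappa>" and shift: "left_shift ` \<Gamma> \<subseteq> \<Gamma>"
    and nonneg: "\<And>i. 0 \<le> w i"
    and submult: "\<And>i j. i @ j \<in> finite_words \<Gamma> \<Longrightarrow> w (i @ j) \<le> w i * w j"
    and F: "finite F" "[] \<notin> F" and cover: "\<And>k. k \<in> \<Gamma> \<Longrightarrow> \<exists>m. trunc m k \<in> F"
    and lt1: "sum w F < 1"
  shows "(\<lambda>n. sum w (words_of_length \<Gamma> n)) \<longlonglongrightarrow> 0"
proof -
  define T where "T n = sum w (words_of_length \<Gamma> n)" for n
  define \<theta> where "\<theta> = sum w F"
  define M where "M = Max (insert 1 (length ` F))"
  define K where "K = (\<Sum>n<M. T n)"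
  have T_nonneg: "0 \<le> T n" for n by (simp add: T_def sum_nonneg nonneg)
  have \<theta>: "0 \<le> \<theta>" "\<theta> < 1" using lt1 by (auto simp: \<theta>_def sum_nonneg nonneg)
  have len_le: "length f \<le> M" if "f \<in> F" for f
    using F(1) that by (auto simp: M_def intro!: Max_ge)
  have M1: "1 \<le> M" using F(1) by (auto simp: M_def intro!: Max_ge)
  have K: "0 \<le> K" by (simp add: K_def sum_nonneg T_nonneg)
  have bound: "T n \<le> K * \<theta> ^ (n div M)" for n
  proof (induction n rule: less_induct)
    case (less n)
    show ?case
    proof (cases "n < M")
      case True
      then show ?thesis
        using member_le_sum[of n "{..<M}" T] T_nonneg by (simp add: K_def)
    next
      case False
      then have nM: "M \<le> n" by simp
      have "\<exists>m\<le>n. trunc m k \<in> F" if k: "k \<in> \<Gamma>" for k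
      proof -
        obtain m where "trunc m k \<in> F" using cover[OF k] by blast
        moreover from this have "m \<le> n" using len_le[of "trunc m k"] nM by simp
        ultimately show ?thesis by blast
      qed
      then have "T n \<le> (\<Sum>f\<in>F. w f * T (n - length f))"
        unfolding T_def by (intro sum_words_le_sum_prefixes[OF sub shift nonneg submult F(1)])
      also have "\<dots> \<le> (\<Sum>f\<in>F. w f * (K * \<theta> ^ (n div M - 1)))"
      proof (intro sum_mono mult_left_mono nonneg)
        fix f assume f: "f \<in> F"
        then have "0 < length f" using F(2) by auto
        then have "T (n - length f) \<le> K * \<theta> ^ ((n - length f) div M)"
          using M1 nM by (intro less.IH) auto
        also have "\<dots> \<le> K * \<theta> ^ (n div M - 1)"
        proof (intro mult_left_mono power_decreasing K)
          have "n div M - 1 = (n - M) div M" using M1 nM by (simp add: le_div_geq)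
          also have "\<dots> \<le> (n - length f) div M"
            using len_le[OF f] by (intro div_le_mono) auto
          finally show "n div M - 1 \<le> (n - length f) div M" .
        qed (use \<theta> in auto)
        finally show "T (n - length f) \<le> K * \<theta> ^ (n div M - 1)" .
      qed
      also have "\<dots> = K * (\<theta> * \<theta> ^ (n div M - 1))"
        by (simp add: \<theta>_def flip: sum_distrib_right)
      also have "\<theta> * \<theta> ^ (n div M - 1) = \<theta> ^ (n div M)"
        using nM M1 by (subst power_Suc[symmetric]) (simp add: div_greater_zero_iff)
      finally show ?thesis .
    qed
  qed
  have "filterlim (\<lambda>n. n div M) sequentially sequentially"
    unfolding filterlim_at_top
  proof
    fix Z
    show "\<forall>\<^sub>F n in sequentially. Z \<le> n div M"
      using eventually_ge_at_top[of "Z * M"]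
      by eventually_elim (use M1 in \<open>simp add: less_eq_div_iff_mult_less_eq\<close>)
  qed
  then have "(\<lambda>n. \<theta> ^ (n div M)) \<longlonglongrightarrow> 0"
    using \<theta> by (intro filterlim_compose[OF LIMSEQ_realpow_zero]) auto
  then have "(\<lambda>n. K * \<theta> ^ (n div M)) \<longlonglongrightarrow> 0" by (rule tendsto_mult_right_zero)
  then have "T \<longlonglongrightarrow> 0"
    by (rule tendsto_sandwich[rotated -1]) (auto simp: T_nonneg bound)
  then show ?thesis by (simp add: T_def[abs_def])
qed


section \<open>Comparison of Hausdorff measures and dimensions\<close>

lemma diameter_cball_le:
  fixes x :: "'a::metric_space"
  assumes "0 \<le> r"
  shows "diameter (cball x r) \<le> 2 * r"
proof -
  have "dist y z \<le> 2 * r" if "y \<in> cball x r" "z \<in> cball x r" for y z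
    using that dist_triangle3[of y z x] by simp
  moreover have "cball x r \<noteq> {}" using assms by simp
  ultimately show ?thesis
    unfolding diameter_def by (auto intro!: cSUP_least)
qed

lemma hausdorff_premeasure_le_sum:
  assumes "finite I" and cover: "A \<subseteq> (\<Union>i\<in>I. V i)"
    and V: "\<And>i. i \<in> I \<Longrightarrow> bounded (V i) \<and> diameter (V i) \<le> \<delta>" and "0 \<le> \<delta>"
  shows "hausdorff_premeasure s \<delta> A \<le> (\<Sum>i\<in>I. hausdorff_gauge s (V i))"
proof -
  obtain h where h: "bij_betw h {0..<card I} I"
    using ex_bij_betw_nat_finite[OF \<open>finite I\<close>] by blast
  define U where "U n = (if n < card I then V (h n) else {})" for n
  have hI: "h n \<in> I" if "n < card I" for n
    using h that by (auto simp: bij_betw_def)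
  have "A \<subseteq> (\<Union>n. U n)"
  proof
    fix x assume "x \<in> A"
    then obtain i where "i \<in> I" "x \<in> V i" using cover by blast
    moreover from this obtain n where "n < card I" "h n = i"
      using bij_betw_imp_surj_on[OF h] by (metis atLeastLessThan_iff imageE)
    ultimately have "x \<in> U n" by (auto simp: U_def)
    then show "x \<in> (\<Union>n. U n)" by blast
  qed
  moreover have "bounded (U n) \<and> diameter (U n) \<le> \<delta>" for n
    using V[OF hI, of n] \<open>0 \<le> \<delta>\<close> by (simp add: U_def)
  ultimately have "hausdorff_premeasure s \<delta> A \<le> (\<Sum>n. hausdorff_gauge s (U n))"
    unfolding hausdorff_premeasure_def by (intro INF_lower) auto
  also have "\<dots> = (\<Sum>n\<in>{0..<card I}. hausdorff_gauge s (U n))"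
    by (intro suminf_finite) (auto simp: U_def hausdorff_gauge_def)
  also have "\<dots> = (\<Sum>n\<in>{0..<card I}. hausdorff_gauge s (V (h n)))"
    by (intro sum.cong) (auto simp: U_def)
  also have "\<dots> = (\<Sum>i\<in>I. hausdorff_gauge s (V i))"
    by (rule sum.reindex_bij_betw[OF h])
  finally show ?thesis .
qed

lemma hausdorff_gauge_mono:
  assumes "0 \<le> s" "s < t" "bounded U" "diameter U \<le> 1"
  shows "hausdorff_gauge t U \<le> hausdorff_gauge s U"
proof -
  have "0 \<le> diameter U" using assms by (simp add: diameter_ge_0)
  moreover from this have "diameter U powr t \<le> 1" using assms powr_le1[of t] by simp
  ultimately show ?thesis
    using assms powr_mono'[of s t "diameter U"]
    by (auto simp: hausdorff_gauge_def ennreal_le_1 intro!: ennreal_leI)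
qed

lemma le_hausdorff_dim:
  assumes "0 < hausdorff_measure t A"
  shows "ereal t \<le> hausdorff_dim A"
  unfolding hausdorff_dim_def
proof (intro Inf_greatest, clarify)
  fix s :: real assume s: "0 \<le> s" and zero: "hausdorff_measure s A = 0"
  show "ereal t \<le> ereal s"
  proof (rule ccontr)
    assume "\<not> ereal t \<le> ereal s"
    then have "s < t" by simp
    have "hausdorff_premeasure t \<delta> A \<le> 0" if \<delta>: "0 < \<delta>" for \<delta>
    proof -
      have "hausdorff_premeasure t \<delta> A \<le> hausdorff_premeasure s (min \<delta> 1) A"
        unfolding hausdorff_premeasure_def
        by (rule INF_mono) (fastforce intro!: bexI suminf_le hausdorff_gauge_mono[OF s \<open>s < t\<close>])
      also have "\<dots> \<le> hausdorff_measure s A"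
        unfolding hausdorff_measure_def using \<delta> by (intro SUP_upper) auto
      finally show ?thesis using zero by simp
    qed
    then have "hausdorff_measure t A \<le> 0"
      unfolding hausdorff_measure_def by (intro SUP_least) auto
    with assms show False by simp
  qed
qed

text \<open>A bounded set lies in one ball, so an exponent \<open>u\<close> that is admissible for the Assouad
  dimension yields covers by \<open>O(r powr - u)\<close> balls of radius \<open>r\<close>.  Their total
  \<open>s\<close>-dimensional size \<open>O(r powr (s - u))\<close> vanishes with \<open>r\<close> for every \<open>s > u\<close>.\<close>

lemma hausdorff_dim_le_assouad_dim:
  assumes "bounded A"
  shows "hausdorff_dim A \<le> assouad_dim A"
  unfolding assouad_dim_def
proof (intro Inf_greatest, clarify)
  fix u C :: real
  assume u: "0 \<le> u" and C: "1 \<le> C" and covers: "\<forall>x\<in>A. \<forall>r R. 0 < r \<and> r < R \<longrightarrow>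
    (\<exists>F\<subseteq>A. finite F \<and> real (card F) \<le> C * (r / R) powr - u \<and> A \<inter> cball x R \<subseteq> (\<Union>y\<in>F. cball y r))"
  obtain z e where e: "\<And>y. y \<in> A \<Longrightarrow> dist z y \<le> e"
    using \<open>bounded A\<close> unfolding bounded_def by blast
  define R where "R = 2 * \<bar>e\<bar> + 1"
  have R: "0 < R" by (simp add: R_def)
  have sub: "A \<subseteq> cball x R" if x: "x \<in> A" for x
  proof
    fix y assume "y \<in> A"
    then have "dist x y \<le> e + e" using e[OF x] e[of y] dist_triangle3[of x y z] by simp
    then show "y \<in> cball x R" by (simp add: R_def)
  qed
  have cov: "\<exists>F. finite F \<and> real (card F) \<le> C * (r / R) powr - u \<and> A \<subseteq> (\<Union>y\<in>F. cball y r)"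
    if r: "0 < r" "r < R" for r
  proof (cases "A = {}")
    case True
    then show ?thesis using C by (intro exI[of _ "{}"]) auto
  next
    case False
    then obtain x where x: "x \<in> A" by blast
    with covers r obtain F where "finite F" "real (card F) \<le> C * (r / R) powr - u"
      "A \<inter> cball x R \<subseteq> (\<Union>y\<in>F. cball y r)" by meson
    with sub[OF x] show ?thesis by (intro exI[of _ F]) auto
  qed
  show "hausdorff_dim A \<le> ereal u"
  proof (rule ereal_le_epsilon2)
    fix \<epsilon> :: real assume \<epsilon>: "0 < \<epsilon>"
    define s where "s = u + \<epsilon>"
    define h where "h r = C * (r / R) powr - u * (2 * r) powr s" for r
    have s: "0 < s" "u < s" using u \<epsilon> by (auto simp: s_def)
    have "((\<lambda>r. C * R powr u * 2 powr s * r powr \<epsilon>) \<longlongrightarrow> C * R powr u * 2 powr s * 0) (at_right 0)"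
      using \<epsilon> by (intro tendsto_mult tendsto_const tendsto_zero_powrI[where b = \<epsilon>])
        (auto simp: eventually_at_filter tendsto_ident_at)
    moreover have "\<forall>\<^sub>F r in at_right 0. C * R powr u * 2 powr s * r powr \<epsilon> = h r"
      using eventually_at_right_less[of 0]
    proof eventually_elim
      case (elim r)
      have "(r / R) powr - u = R powr u / r powr u"
        using elim R by (simp add: powr_divide powr_minus field_simps)
      moreover have "(2 * r) powr s = 2 powr s * (r powr u * r powr \<epsilon>)"
        using elim by (simp add: powr_mult s_def powr_add)
      ultimately show ?case using elim by (simp add: h_def)
    qed
    ultimately have "(h \<longlongrightarrow> 0) (at_right 0)" using tendsto_cong by fastforce
    then have lim: "((\<lambda>r. ennreal (h r)) \<longlongrightarrow> 0) (at_right 0)"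
      using tendsto_ennrealI by fastforce
    have "hausdorff_premeasure s \<delta> A \<le> 0" if \<delta>: "0 < \<delta>" for \<delta>
    proof (rule tendsto_lowerbound[OF lim])
      have "\<forall>\<^sub>F r in at_right 0. r < min (\<delta> / 2) R"
        by (rule order_tendstoD[OF tendsto_ident_at]) (use \<delta> R in auto)
      then show "\<forall>\<^sub>F r in at_right 0. hausdorff_premeasure s \<delta> A \<le> ennreal (h r)"
        using eventually_at_right_less[of 0]
      proof eventually_elim
        case (elim r)
        then have r: "0 < r" "r < R" "2 * r \<le> \<delta>" by auto
        obtain F where F: "finite F" "real (card F) \<le> C * (r / R) powr - u"
          "A \<subseteq> (\<Union>y\<in>F. cball y r)" using cov[OF r(1,2)] by blast
        have diam: "diameter (cball y r) \<le> 2 * r" for y :: 'a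
          using r by (intro diameter_cball_le) simp
        have "hausdorff_premeasure s \<delta> A \<le> (\<Sum>y\<in>F. hausdorff_gauge s (cball y r))"
          using F diam r \<delta> by (intro hausdorff_premeasure_le_sum) (auto intro: order_trans)
        also have "\<dots> \<le> (\<Sum>y\<in>F. ennreal ((2 * r) powr s))"
          using s r diam
          by (intro sum_mono) (auto simp: hausdorff_gauge_def diameter_ge_0
              intro!: ennreal_leI powr_mono2)
        also have "\<dots> = ennreal (real (card F) * (2 * r) powr s)"
          by (simp add: ennreal_mult ennreal_of_nat_eq_real_of_nat)
        also have "\<dots> \<le> ennreal (h r)"
          unfolding h_def using F by (intro ennreal_leI mult_right_mono) auto
        finally show ?case .
      qed
    qed simp
    then have "hausdorff_measure s A \<le> 0"
      unfolding hausdorff_measure_def by (intro SUP_least) auto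
    then have "hausdorff_dim A \<le> ereal s"
      unfolding hausdorff_dim_def using s by (intro Inf_lower) auto
    then show "hausdorff_dim A \<le> ereal u + ereal \<epsilon>" by (simp add: s_def)
  qed
qed


section \<open>Moran constructions with submultiplicative diameters\<close>

text \<open>Zero pressure forces \<open>\<Gamma>\<close> to be non-empty; the empty word is then a word of \<open>\<Gamma>\<close>, and
  \<open>E []\<close> is a set of positive diameter that contains the whole construction.\<close>

locale moran_system =
  fixes \<kappa> :: nat and \<Gamma> :: "word set" and E :: "nat list \<Rightarrow> 'a::complete_space set" and D \<alpha> :: real
  assumes sub: "\<Gamma> \<subseteq> full_shift \<kappa>"
    and compact: "compactin (Metric_space.mtopology (full_shift \<kappa>) word_dist) \<Gamma>"
    and shift: "left_shift ` \<Gamma> \<subseteq> \<Gamma>"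
    and nonempty: "\<Gamma> \<noteq> {}"
    and moran: "moran_construction \<Gamma> E"
    and D: "1 \<le> D"
    and diam_append: "\<And>i j. i @ j \<in> finite_words \<Gamma> \<Longrightarrow>
      diameter (E (i @ j)) \<le> D * diameter (E i) * diameter (E j)"
    and \<alpha>: "0 < \<alpha>" "\<alpha> < 1"
    and diam_butlast: "\<And>i. i \<in> finite_words \<Gamma> \<Longrightarrow> i \<noteq> [] \<Longrightarrow>
      \<alpha> * diameter (E (butlast i)) \<le> diameter (E i)"
begin

abbreviation diam :: "nat list \<Rightarrow> real" where
  "diam i \<equiv> diameter (E i)"

abbreviation partition_sum :: "real \<Rightarrow> nat \<Rightarrow> real" where
  "partition_sum s n \<equiv> (\<Sum>i\<in>words_of_length \<Gamma> n. diam i powr s)"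

lemma closed_E: "i \<in> finite_words \<Gamma> \<Longrightarrow> closed (E i)"
  and bounded_E: "i \<in> finite_words \<Gamma> \<Longrightarrow> bounded (E i)"
  and diam_pos: "i \<in> finite_words \<Gamma> \<Longrightarrow> 0 < diam i"
  using moran by (auto simp: moran_construction_def)

lemma Nil_mem: "[] \<in> finite_words \<Gamma>"
  using nonempty trunc_mem_finite_words[of _ \<Gamma> 0] by auto

lemma E_trunc_mono:
  assumes "k \<in> \<Gamma>" "m \<le> n"
  shows "E (trunc n k) \<subseteq> E (trunc m k)"
  using \<open>m \<le> n\<close>
proof (induction rule: dec_induct)
  case (step n)
  have "trunc (Suc n) k \<in> finite_words \<Gamma> - {[]}"
    using assms(1) by auto
  then have "E (trunc (Suc n) k) \<subseteq> E (butlast (trunc (Suc n) k))"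
    using moran unfolding moran_construction_def by blast
  with step show ?case by auto
qed simp

lemma diam_trunc_mono: "k \<in> \<Gamma> \<Longrightarrow> m \<le> n \<Longrightarrow> diam (trunc n k) \<le> diam (trunc m k)"
  by (intro diameter_subset E_trunc_mono bounded_E) auto

lemma diam_trunc_tendsto_0: "k \<in> \<Gamma> \<Longrightarrow> (\<lambda>n. diam (trunc n k)) \<longlonglongrightarrow> 0"
  using moran by (simp add: moran_construction_def)

lemma diam_le_Nil: "i \<in> finite_words \<Gamma> \<Longrightarrow> diam i \<le> diam []"
  by (metis diam_trunc_mono finite_wordsE le0 trunc_0)

lemma dist_le_diam: "i \<in> finite_words \<Gamma> \<Longrightarrow> x \<in> E i \<Longrightarrow> y \<in> E i \<Longrightarrow> dist x y \<le> diam i"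
  by (intro diameter_bounded_bound bounded_E)

text \<open>The intersection in the definition of the projection is a singleton by Cantor's intersection
  theorem; this is where completeness is used.\<close>

lemma moran_proj_mem:
  assumes k: "k \<in> \<Gamma>"
  shows "moran_proj E k \<in> E (trunc n k)"
proof -
  define S where "S n = E (trunc (Suc n) k)" for n
  have fw: "trunc n k \<in> finite_words \<Gamma>" for n using k by auto
  have "\<exists>a. \<Inter>(range S) = {a}"
  proof (rule decreasing_closed_nest_sing)
    show "closed (S n)" for n using closed_E[OF fw] by (simp add: S_def)
    show "S n \<noteq> {}" for n using diam_pos[OF fw, of "Suc n"] by (auto simp: S_def)
    show "S n \<subseteq> S m" if "m \<le> n" for m n
      using E_trunc_mono[OF k, of "Suc m" "Suc n"] that by (simp add: S_def)
    show "\<exists>n. \<forall>x\<in>S n. \<forall>y\<in>S n. dist x y < \<epsilon>" if "\<epsilon> > 0" for \<epsilon> :: real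
    proof -
      have "\<forall>\<^sub>F n in sequentially. diam (trunc n k) < \<epsilon>"
        using diam_trunc_tendsto_0[OF k] that by (rule order_tendstoD)
      then obtain n where "diam (trunc (Suc n) k) < \<epsilon>"
        unfolding eventually_sequentially using le_Suc_eq by blast
      then show ?thesis
        using dist_le_diam[OF fw, of _ "Suc n"] unfolding S_def by (meson le_less_trans)
    qed
  qed
  then obtain a where a: "\<Inter>(range S) = {a}" by blast
  have "{1..} = range Suc"
    by (auto simp: image_iff) (metis Suc_le_D One_nat_def)
  then have "(\<Inter>n\<in>{1..}. E (trunc n k)) = \<Inter>(range S)"
    by (auto simp: S_def)
  with a have "moran_proj E k = a" by (simp add: moran_proj_def)
  then have "moran_proj E k \<in> E (trunc (Suc n) k)" using a by (auto simp: S_def)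
  then show ?thesis using E_trunc_mono[OF k, of n "Suc n"] by auto
qed

lemma limit_set_subset: "limit_set \<Gamma> E \<subseteq> E []"
  using moran_proj_mem[of _ 0] by (auto simp: limit_set_def)

text \<open>By compactness, finitely many words \<open>f\<close> with \<open>D * diam f \<le> 1/2\<close> contain a prefix of
  every element of \<open>\<Gamma>\<close>.  By submultiplicativity, cutting off such a prefix of length at most
  \<open>M\<close> at least halves the bound for the diameter, so diameters decay exponentially at rate
  \<open>ln 2 / M\<close>, uniformly over all words.\<close>

lemma diam_exponential_decay:
  obtains K c where "0 < K" "0 < c"
    "\<And>i. i \<in> finite_words \<Gamma> \<Longrightarrow> diam i \<le> K * exp (- (c * real (length i)))"
proof -
  define F where "F = {i \<in> finite_words \<Gamma>. i \<noteq> [] \<and> D * diam i \<le> 1/2}"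
  have "\<exists>m. trunc m k \<in> F" if k: "k \<in> \<Gamma>" for k
  proof -
    have "(\<lambda>n. D * diam (trunc n k)) \<longlonglongrightarrow> D * 0"
      by (intro tendsto_intros diam_trunc_tendsto_0 k)
    then have "\<forall>\<^sub>F n in sequentially. D * diam (trunc n k) < 1/2"
      by (rule order_tendstoD) simp
    then obtain n where "D * diam (trunc (Suc n) k) < 1/2"
      unfolding eventually_sequentially using le_Suc_eq by blast
    then have "trunc (Suc n) k \<in> F" using k by (auto simp: F_def)
    then show ?thesis by blast
  qed
  then obtain F' where F': "finite F'" "F' \<subseteq> F" "\<And>k. k \<in> \<Gamma> \<Longrightarrow> \<exists>m. trunc m k \<in> F'"
    using finite_prefix_subcover[OF sub compact] by metis
  define M where "M = Max (insert 1 (length ` F'))"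
  have len_le: "length f \<le> M" if "f \<in> F'" for f
    using F'(1) that by (auto simp: M_def intro!: Max_ge)
  have M1: "1 \<le> M" using F'(1) by (auto simp: M_def intro!: Max_ge)
  define c where "c = ln 2 / real M"
  define K where "K = 2 * diam []"
  have c: "0 < c" using M1 by (simp add: c_def)
  have K: "0 < K" using diam_pos[OF Nil_mem] by (simp add: K_def)
  have exp_M: "exp (- (c * real M)) = 1/2" using M1 by (simp add: c_def exp_minus)
  have "diam i \<le> K * exp (- (c * real (length i)))" if "i \<in> finite_words \<Gamma>" for i
    using that
  proof (induction "length i" arbitrary: i rule: less_induct)
    case less
    show ?case
    proof (cases "length i < M")
      case True
      have "1/2 \<le> exp (- (c * real (length i)))"
        unfolding exp_M[symmetric] using True c by simp
      then have "K * (1/2) \<le> K * exp (- (c * real (length i)))"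
        using K by (intro mult_left_mono) auto
      then show ?thesis using diam_le_Nil[OF less.prems] by (simp add: K_def)
    next
      case False
      obtain k where k: "k \<in> \<Gamma>" "i = trunc (length i) k" using less.prems by (rule finite_wordsE)
      obtain m where m: "trunc m k \<in> F'" using F'(3)[OF k(1)] by blast
      then have mM: "m \<le> M" using len_le[OF m] by simp
      have m0: "0 < m" using m F'(2) by (cases m) (auto simp: F_def)
      define v where "v = trunc (length i - m) ((left_shift ^^ m) k)"
      have i: "i = trunc m k @ v"
        using trunc_add[of m "length i - m" k] mM False k(2) by (simp add: v_def)
      have v: "v \<in> finite_words \<Gamma>"
        using less.prems unfolding i by (rule finite_words_appendD(2)[OF shift])
      have lv: "length v = length i - m" by (simp add: v_def)
      have "diam i \<le> D * diam (trunc m k) * diam v"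
        unfolding i using less.prems i by (intro diam_append) simp
      also have "\<dots> \<le> 1/2 * diam v"
        using m F'(2) diam_pos[OF v] by (intro mult_right_mono) (auto simp: F_def)
      also have "\<dots> \<le> 1/2 * (K * exp (- (c * real (length v))))"
        using lv m0 mM False v by (intro mult_left_mono less.hyps) auto
      also have "\<dots> = K * exp (- (c * real M) + - (c * real (length v)))"
        unfolding exp_add exp_M by simp
      also have "\<dots> \<le> K * exp (- (c * real (length i)))"
      proof -
        have "c * real (length i) \<le> c * (real M + real (length v))"
          using lv mM c by (intro mult_left_mono) auto
        then show ?thesis using K by (intro mult_left_mono) (auto simp: algebra_simps)
      qed
      finally show ?thesis .
    qed
  qed
  with K c show ?thesis using that by blast
qed

lemma powr_weight_append:
  assumes "0 \<le> t" "i @ j \<in> finite_words \<Gamma>"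
  shows "(D * diam (i @ j)) powr t \<le> (D * diam i) powr t * (D * diam j) powr t"
proof -
  have "D * diam (i @ j) \<le> D * (D * diam i * diam j)"
    using D by (intro mult_left_mono diam_append assms(2)) auto
  then have "(D * diam (i @ j)) powr t \<le> ((D * diam i) * (D * diam j)) powr t"
    using assms(1) D diam_pos[OF assms(2)] by (intro powr_mono2) (auto simp: ac_simps)
  then show ?thesis by (simp only: powr_mult[of "D * diam i" "D * diam j"])
qed

lemma sum_weight_eq:
  "(\<Sum>i\<in>words_of_length \<Gamma> n. (D * diam i) powr t) = D powr t * partition_sum t n"
  unfolding sum_distrib_left
  by (intro sum.cong refl powr_mult)

lemma power_le_diam:
  assumes "k \<in> \<Gamma>"
  shows "\<alpha> ^ n * diam [] \<le> diam (trunc n k)"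
proof (induction n)
  case (Suc n)
  have "\<alpha> * diam (trunc n k) \<le> diam (trunc (Suc n) k)"
    using diam_butlast[of "trunc (Suc n) k"] assms by auto
  with mult_left_mono[OF Suc less_imp_le[OF \<alpha>(1)]] show ?case
    unfolding power_Suc mult.assoc by (rule order_trans)
qed simp

text \<open>The logarithm of \<open>D powr t * partition_sum t n\<close> is subadditive in \<open>n\<close>, and its quotient by
  \<open>n\<close> is bounded below because \<open>diam (trunc n k) \<ge> \<alpha> ^ n * diam []\<close>.  So by Fekete's lemma the
  limit in the definition of the pressure exists and is a lower bound of these quotients.  Zero pressure
  therefore gives a lower bound for the partition sums that is uniform in \<open>n\<close>, but only a
  subexponential upper bound.\<close>

lemma partition_sum_bounds:
  assumes t: "0 \<le> t" and pressure: "pressure \<Gamma> E t = 0"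
  shows "0 < n \<Longrightarrow> 1 \<le> D powr t * partition_sum t n"
    and "0 < \<epsilon> \<Longrightarrow> \<forall>\<^sub>F n in sequentially. partition_sum t n \<le> exp (\<epsilon> * real n)"
proof -
  define w where "w i = (D * diam i) powr t" for i
  define T where "T n = sum w (words_of_length \<Gamma> n)" for n
  define a where "a n = ln (T n)" for n
  have T_eq: "T n = D powr t * partition_sum t n" for n
    using sum_weight_eq by (simp add: T_def w_def)
  obtain k where k: "k \<in> \<Gamma>" using nonempty by blast
  have fin: "finite (words_of_length \<Gamma> n)" for n by (rule finite_words_of_length[OF sub])
  have term_le: "diam (trunc n k) powr t \<le> partition_sum t n" for n
    using k fin by (intro member_le_sum) auto
  have Z_pos: "0 < partition_sum t n" for n
    using term_le[of n] diam_pos[of "trunc n k"] k by (smt (verit) powr_gt_zero trunc_mem_finite_words)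
  have T_pos: "0 < T n" for n using Z_pos D by (simp add: T_eq)
  have "T (m + n) \<le> T m * T n" for m n
  proof -
    have "T (m + n) \<le> (\<Sum>f\<in>words_of_length \<Gamma> m. w f * T (m + n - length f))"
      unfolding T_def
      by (rule sum_words_le_sum_prefixes[OF sub shift])
        (auto simp: w_def fin intro!: powr_weight_append t exI[of _ m])
    also have "\<dots> = (\<Sum>f\<in>words_of_length \<Gamma> m. w f * T n)"
      by (intro sum.cong refl) (simp add: length_words_of_length)
    finally show ?thesis by (simp add: T_def sum_distrib_right)
  qed
  then have suba: "a (m + n) \<le> a m + a n" for m n
    unfolding a_def using T_pos by (subst ln_mult_pos[symmetric]) (auto intro!: ln_mono)
  have bdd: "t * ln \<alpha> - t * \<bar>ln (diam [])\<bar> \<le> a n / real n" if n: "0 < n" for n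
  proof -
    have d0: "0 < diam []" by (rule diam_pos[OF Nil_mem])
    have "(\<alpha> ^ n * diam []) powr t \<le> diam (trunc n k) powr t"
      using \<alpha> d0 t by (intro powr_mono2 power_le_diam k) auto
    also have "\<dots> \<le> 1 * partition_sum t n" using term_le by simp
    also have "\<dots> \<le> T n"
      unfolding T_eq using Z_pos[of n] D t ge_one_powr_ge_zero[of D t] by (intro mult_right_mono) auto
    finally have "ln ((\<alpha> ^ n * diam []) powr t) \<le> a n"
      unfolding a_def using \<alpha> d0 T_pos[of n] by (intro ln_mono) auto
    then have "t * (real n * ln \<alpha> + ln (diam [])) \<le> a n"
      using \<alpha> d0 by (simp add: ln_powr ln_mult_pos ln_realpow)
    moreover have "real n * (t * ln \<alpha> - t * \<bar>ln (diam [])\<bar>) \<le> t * (real n * ln \<alpha> + ln (diam []))"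
    proof -
      have "- \<bar>ln (diam [])\<bar> * real n \<le> - \<bar>ln (diam [])\<bar> * 1"
        using n by (intro mult_left_mono_neg) auto
      then have "- \<bar>ln (diam [])\<bar> * real n \<le> ln (diam [])" by linarith
      from mult_left_mono[OF this t] show ?thesis by (simp add: algebra_simps)
    qed
    ultimately show ?thesis using n by (simp add: pos_le_divide_eq mult.commute)
  qed
  obtain L where L: "(\<lambda>n. a n / real n) \<longlonglongrightarrow> L" "\<And>n. 0 < n \<Longrightarrow> L \<le> a n / real n"
    using subadditive_quotient_tendsto_Inf[OF suba bdd] by blast
  have "(\<lambda>n. a n / real n - t * ln D / real n) \<longlonglongrightarrow> L - 0"
    by (intro tendsto_diff L(1) lim_const_over_n)
  moreover have "a n / real n - t * ln D / real n = 1 / real n * ln (partition_sum t n)" for n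
    using D Z_pos[of n] by (simp add: a_def T_eq ln_mult_pos ln_powr add_divide_distrib)
  ultimately have lim: "(\<lambda>n. 1 / real n * ln (partition_sum t n)) \<longlonglongrightarrow> L" by simp
  then have "(\<lambda>n. ereal (1 / real n) * ext_log (partition_sum t n)) \<longlonglongrightarrow> ereal L"
    using Z_pos by (simp add: ext_log_def less_imp_neq[symmetric])
  then have "pressure \<Gamma> E t = ereal L" unfolding pressure_def by (rule limI)
  then have L0: "L = 0" using pressure by simp
  show "1 \<le> D powr t * partition_sum t n" if "0 < n"
    using L(2)[OF that] that T_pos[of n] L0 by (simp add: a_def T_eq zero_le_divide_iff)
  show "\<forall>\<^sub>F n in sequentially. partition_sum t n \<le> exp (\<epsilon> * real n)" if "0 < \<epsilon>"
  proof -
    have "\<forall>\<^sub>F n in sequentially. 1 / real n * ln (partition_sum t n) < \<epsilon>"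
      using lim that L0 by (intro order_tendstoD) auto
    then show ?thesis using eventually_gt_at_top[of 0]
    proof eventually_elim
      case (elim n)
      then have "ln (partition_sum t n) \<le> \<epsilon> * real n" by (simp add: pos_divide_less_eq)
      then show ?case using Z_pos[of n] by (metis exp_le_cancel_iff exp_ln)
    qed
  qed
qed


section \<open>The Assouad dimension is at most the zero of the pressure\<close>

text \<open>For \<open>s > t\<close> the exponential decay of the factor \<open>diam i powr (s - t)\<close> beats the
  subexponential growth of the partition sums for \<open>t\<close>.\<close>

lemma diam_powr_sums_bounded:
  assumes "t < s"
    and subexp: "\<And>\<epsilon>. 0 < \<epsilon> \<Longrightarrow> \<forall>\<^sub>F n in sequentially. partition_sum t n \<le> exp (\<epsilon> * real n)"
  obtains Q where "0 \<le> Q"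
    "\<And>A. finite A \<Longrightarrow> A \<subseteq> finite_words \<Gamma> \<Longrightarrow> (\<Sum>i\<in>A. diam i powr s) \<le> Q"
proof -
  obtain K c where K: "0 < K" and c: "0 < c"
    and decay: "\<And>i. i \<in> finite_words \<Gamma> \<Longrightarrow> diam i \<le> K * exp (- (c * real (length i)))"
    using diam_exponential_decay by blast
  have fin: "finite (words_of_length \<Gamma> n)" for n by (rule finite_words_of_length[OF sub])
  \<comment> \<open>Half of the decay rate \<open>c * (s - t)\<close> is spent on the growth of the partition sums.\<close>
  define e where "e = c * (s - t) / 2"
  have e: "0 < e" using c \<open>t < s\<close> by (simp add: e_def)
  have step: "partition_sum s n \<le> (K * exp (- (c * real n))) powr (s - t) * partition_sum t n" for n
    unfolding sum_distrib_left
  proof (rule sum_mono)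
    fix i assume i: "i \<in> words_of_length \<Gamma> n"
    then have fw: "i \<in> finite_words \<Gamma>" using words_of_length_subset by blast
    have "diam i powr s = diam i powr (s - t) * diam i powr t"
      by (simp flip: powr_add)
    also have "\<dots> \<le> (K * exp (- (c * real n))) powr (s - t) * diam i powr t"
      using decay[OF fw] length_words_of_length[OF i] diam_pos[OF fw] \<open>t < s\<close>
      by (intro mult_right_mono powr_mono2) auto
    finally show "diam i powr s \<le> (K * exp (- (c * real n))) powr (s - t) * diam i powr t" .
  qed
  have "\<forall>\<^sub>F n in sequentially. norm (partition_sum s n) \<le> K powr (s - t) * exp (- e) ^ n"
    using subexp[OF e]
  proof eventually_elim
    case (elim n)
    have "partition_sum s n \<le> (K * exp (- (c * real n))) powr (s - t) * exp (e * real n)"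
      using step[of n] mult_left_mono[OF elim] by (rule order_trans) simp
    also have "\<dots> = K powr (s - t) * (exp (- (c * real n) * (s - t)) * exp (e * real n))"
      by (simp only: powr_mult exp_powr_real mult.assoc)
    also have "exp (- (c * real n) * (s - t)) * exp (e * real n) = exp (real n * (- e))"
      unfolding exp_add[symmetric] by (simp add: e_def field_simps)
    also have "\<dots> = exp (- e) ^ n" by (rule exp_of_nat_mult)
    finally show ?case by (simp add: sum_nonneg)
  qed
  then have sm: "summable (partition_sum s)"
    by (rule summable_comparison_test_ev) (use e in \<open>auto intro!: summable_mult summable_geometric\<close>)
  have bound: "(\<Sum>i\<in>A. diam i powr s) \<le> suminf (partition_sum s)"
    if A: "finite A" "A \<subseteq> finite_words \<Gamma>" for A
  proof -
    have "(\<Sum>i\<in>A. diam i powr s) = (\<Sum>n\<in>length ` A. \<Sum>i\<in>{i \<in> A. length i = n}. diam i powr s)"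
      by (rule sum.image_gen[OF A(1)])
    also have "\<dots> \<le> (\<Sum>n\<in>length ` A. partition_sum s n)"
    proof (intro sum_mono sum_mono2 fin subsetI)
      fix n i assume "i \<in> {i \<in> A. length i = n}"
      then show "i \<in> words_of_length \<Gamma> n" using A(2) mem_words_of_length_length[of i \<Gamma>] by auto
    qed simp
    also have "\<dots> \<le> suminf (partition_sum s)"
      using A(1) sm by (intro sum_le_suminf) (auto intro: sum_nonneg)
    finally show ?thesis .
  qed
  show ?thesis using bound[of "{}"] by (intro that[OF _ bound]) auto
qed

text \<open>Chebyshev's inequality for the bounded sums of \<open>diam i powr s\<close>.\<close>

lemma card_words_of_large_diam:
  assumes "0 \<le> t" "t < s"
    and subexp: "\<And>\<epsilon>. 0 < \<epsilon> \<Longrightarrow> \<forall>\<^sub>F n in sequentially. partition_sum t n \<le> exp (\<epsilon> * real n)"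
  obtains Q where "0 \<le> Q" "\<And>\<rho>. 0 < \<rho> \<Longrightarrow> finite {i \<in> finite_words \<Gamma>. \<rho> \<le> diam i}"
    "\<And>\<rho>. 0 < \<rho> \<Longrightarrow> real (card {i \<in> finite_words \<Gamma>. \<rho> \<le> diam i}) \<le> Q * \<rho> powr - s"
proof -
  obtain Q where Q: "0 \<le> Q"
    "\<And>A. finite A \<Longrightarrow> A \<subseteq> finite_words \<Gamma> \<Longrightarrow> (\<Sum>i\<in>A. diam i powr s) \<le> Q"
    using diam_powr_sums_bounded[OF \<open>t < s\<close> subexp] by blast
  have card_le: "real (card A) \<le> Q * \<rho> powr - s"
    if \<rho>: "0 < \<rho>" and A: "finite A" "A \<subseteq> {i \<in> finite_words \<Gamma>. \<rho> \<le> diam i}" for A \<rho>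
  proof -
    have "real (card A) * \<rho> powr s = (\<Sum>i\<in>A. \<rho> powr s)" by simp
    also have "\<dots> \<le> (\<Sum>i\<in>A. diam i powr s)"
      using A \<rho> assms by (intro sum_mono powr_mono2) auto
    also have "\<dots> \<le> Q" using A by (intro Q(2)) auto
    finally show ?thesis using \<rho> by (simp add: powr_minus field_simps)
  qed
  have fin: "finite {i \<in> finite_words \<Gamma>. \<rho> \<le> diam i}" if \<rho>: "0 < \<rho>" for \<rho>
  proof (rule ccontr)
    assume inf: "infinite {i \<in> finite_words \<Gamma>. \<rho> \<le> diam i}"
    obtain n where n: "Q * \<rho> powr - s < real n" using reals_Archimedean2 by blast
    obtain B where "finite B" "card B = n" "B \<subseteq> {i \<in> finite_words \<Gamma>. \<rho> \<le> diam i}"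
      using infinite_arbitrarily_large[OF inf] by blast
    then show False using card_le[OF \<rho>, of B] n by simp
  qed
  show ?thesis by (rule that[OF Q(1) fin]) (auto intro: card_le fin)
qed

lemma cut_setD:
  assumes "i \<in> cut_set \<Gamma> E r"
  shows "i \<in> finite_words \<Gamma>" "i \<noteq> []" "diam i \<le> r" "r < diam (butlast i)" "\<alpha> * r < diam i"
proof -
  show i: "i \<in> finite_words \<Gamma>" "i \<noteq> []" "diam i \<le> r" "r < diam (butlast i)"
    using assms by (auto simp: cut_set_def)
  have "\<alpha> * r < \<alpha> * diam (butlast i)" using i \<alpha> by simp
  also have "\<dots> \<le> diam i" using i by (intro diam_butlast)
  finally show "\<alpha> * r < diam i" .
qed

lemma prefix_in_cut_set:
  assumes k: "k \<in> \<Gamma>" and r: "0 < r" "r < diam []"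
  obtains n where "trunc (Suc n) k \<in> cut_set \<Gamma> E r"
proof -
  have "\<forall>\<^sub>F n in sequentially. diam (trunc n k) < r"
    using diam_trunc_tendsto_0[OF k] r(1) by (rule order_tendstoD)
  then obtain n0 where n0: "diam (trunc n0 k) \<le> r"
    unfolding eventually_sequentially by (meson le_refl less_imp_le)
  define n where "n = (LEAST n. diam (trunc n k) \<le> r)"
  have n: "diam (trunc n k) \<le> r" 
    unfolding n_def using n0 by (rule LeastI[of "\<lambda>n. diam (trunc n k) \<le> r" n0])
  obtain m where m: "n = Suc m" using n r(2) by (cases n) auto
  have "\<not> diam (trunc m k) \<le> r"
    using not_less_Least[of m "\<lambda>n. diam (trunc n k) \<le> r"] m by (simp add: n_def)
  then have "trunc (Suc m) k \<in> cut_set \<Gamma> E r"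
    using n m k by (auto simp: cut_set_def)
  then show ?thesis by (rule that)
qed

text \<open>A word \<open>w\<close> is replaced by a ball around some point of the limit set in \<open>E w\<close>, because
  the Assouad dimension asks for centers in the set.\<close>

lemma cover_by_balls:
  assumes W: "finite W" "W \<subseteq> finite_words \<Gamma>" "\<And>w. w \<in> W \<Longrightarrow> diam w \<le> r"
    and cover: "\<And>k. k \<in> \<Gamma> \<Longrightarrow> moran_proj E k \<in> A \<Longrightarrow> \<exists>n. trunc n k \<in> W"
  obtains F where "F \<subseteq> limit_set \<Gamma> E" "finite F" "card F \<le> card W"
    "limit_set \<Gamma> E \<inter> A \<subseteq> (\<Union>y\<in>F. cball y r)"
proof -
  have "\<forall>w\<in>W. \<exists>k\<in>\<Gamma>. w = trunc (length w) k"
    using W(2) by (meson finite_wordsE subsetD)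
  then obtain g where g: "\<And>w. w \<in> W \<Longrightarrow> g w \<in> \<Gamma>" "\<And>w. w \<in> W \<Longrightarrow> w = trunc (length w) (g w)"
    by metis
  show ?thesis
  proof
    show "(\<lambda>w. moran_proj E (g w)) ` W \<subseteq> limit_set \<Gamma> E"
      using g by (auto simp: limit_set_def)
    show "finite ((\<lambda>w. moran_proj E (g w)) ` W)" using W(1) by simp
    show "card ((\<lambda>w. moran_proj E (g w)) ` W) \<le> card W" by (rule card_image_le[OF W(1)])
    show "limit_set \<Gamma> E \<inter> A \<subseteq> (\<Union>y\<in>(\<lambda>w. moran_proj E (g w)) ` W. cball y r)"
    proof
      fix y assume "y \<in> limit_set \<Gamma> E \<inter> A"
      then obtain k where k: "k \<in> \<Gamma>" "y = moran_proj E k" "y \<in> A" by (auto simp: limit_set_def)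
      then obtain n where n: "trunc n k \<in> W" using cover by blast
      define w where "w = trunc n k"
      have w: "w \<in> W" "w \<in> finite_words \<Gamma>" using n W(2) by (auto simp: w_def)
      have "y \<in> E w" using moran_proj_mem[OF k(1), of n] k by (simp add: w_def)
      moreover have "moran_proj E (g w) \<in> E w"
        using moran_proj_mem[OF g(1)[OF w(1)], of "length w"] g(2)[OF w(1)] by simp
      ultimately have "dist (moran_proj E (g w)) y \<le> r"
        using dist_le_diam[OF w(2)] W(3)[OF w(1)] by (meson order_trans)
      then show "y \<in> (\<Union>y\<in>(\<lambda>w. moran_proj E (g w)) ` W. cball y r)"
        using w(1) by auto
    qed
  qed
qed

text \<open>Points of the limit set near \<open>x\<close> have an address that begins with one of the boundedly many
  words \<open>i\<close> of \<open>local_cut_set \<Gamma> E x R\<close>, and a prefix \<open>i @ j\<close> in \<open>cut_set \<Gamma> E r\<close>.  Since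
  \<open>diam (i @ j)\<close> is comparable to \<open>r\<close> and at most \<open>D R diam j\<close>, the word \<open>j\<close> has
  \<open>diam j \<ge> \<alpha> r / (D R)\<close>, and there are at most \<open>O((r / R) powr - s)\<close> such words.  If
  \<open>diam [] \<le> R\<close>, then \<open>cut_set \<Gamma> E R\<close> is empty, and the empty word takes
  the place of \<open>i\<close>; if even \<open>diam [] \<le> r\<close>, one ball suffices.\<close>

lemma assouad_dim_le:
  assumes t: "0 \<le> t" "t < s"
    and subexp: "\<And>\<epsilon>. 0 < \<epsilon> \<Longrightarrow> \<forall>\<^sub>F n in sequentially. partition_sum t n \<le> exp (\<epsilon> * real n)"
    and clustering: "uniform_finite_clustering \<Gamma> E"
  shows "assouad_dim (limit_set \<Gamma> E) \<le> ereal s"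
proof -
  obtain N where N: "\<And>x r. x \<in> limit_set \<Gamma> E \<Longrightarrow> 0 < r \<Longrightarrow>
      finite (local_cut_set \<Gamma> E x r) \<and> card (local_cut_set \<Gamma> E x r) \<le> N"
    using clustering unfolding uniform_finite_clustering_def by blast
  obtain Q where Q: "0 \<le> Q" "\<And>\<rho>. 0 < \<rho> \<Longrightarrow> finite {i \<in> finite_words \<Gamma>. \<rho> \<le> diam i}"
    "\<And>\<rho>. 0 < \<rho> \<Longrightarrow> real (card {i \<in> finite_words \<Gamma>. \<rho> \<le> diam i}) \<le> Q * \<rho> powr - s"
    using card_words_of_large_diam[OF t subexp] by blast
  define large where "large \<rho> = {i \<in> finite_words \<Gamma>. \<rho> \<le> diam i}" for \<rho>
  have large: "finite (large \<rho>)" "real (card (large \<rho>)) \<le> Q * \<rho> powr - s" if "0 < \<rho>" for \<rho>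
    using Q(2,3)[OF that] by (auto simp: large_def)
  define C1 where "C1 = real N * Q * (\<alpha> / D) powr - s"
  define C2 where "C2 = Q * (\<alpha> * diam []) powr - s"
  define C where "C = 1 + C1 + C2"
  have C12: "0 \<le> C1" "0 \<le> C2" using Q(1) by (auto simp: C1_def C2_def)
  have d0: "0 < diam []" by (rule diam_pos[OF Nil_mem])
  have cover: "\<exists>F\<subseteq>limit_set \<Gamma> E. finite F \<and> real (card F) \<le> C * (r / R) powr - s \<and>
      limit_set \<Gamma> E \<inter> cball x R \<subseteq> (\<Union>y\<in>F. cball y r)"
    if x: "x \<in> limit_set \<Gamma> E" and r: "0 < r" "r < R" for x r R
  proof -
    define q where "q = r / R"
    have q: "0 < q" "q \<le> 1" using r by (auto simp: q_def)
    have q_ge: "1 \<le> q powr - s"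
      using powr_mono2'[of "- s" q 1] q t by simp
    have from_words: ?thesis
      if W: "finite W" "W \<subseteq> cut_set \<Gamma> E r" and card: "real (card W) \<le> C' * q powr - s" "C' \<le> C"
        and prefix: "\<And>k. k \<in> \<Gamma> \<Longrightarrow> moran_proj E k \<in> cball x R \<Longrightarrow> \<exists>n. trunc n k \<in> W" for W C'
    proof -
      obtain F where F: "F \<subseteq> limit_set \<Gamma> E" "finite F" "card F \<le> card W"
        "limit_set \<Gamma> E \<inter> cball x R \<subseteq> (\<Union>y\<in>F. cball y r)"
      proof (rule cover_by_balls[of W r "cball x R"])
        show "W \<subseteq> finite_words \<Gamma>" using W(2) cut_setD(1) by blast
        show "diam w \<le> r" if "w \<in> W" for w using W(2) that cut_setD(3) by blast
      qed (use W prefix in auto)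
      have "real (card F) \<le> real (card W)" using F(3) by simp
      also have "\<dots> \<le> C * q powr - s"
        using card(1) mult_right_mono[OF card(2), of "q powr - s"] by simp
      finally show ?thesis using F unfolding q_def by blast
    qed
    consider "diam [] \<le> r" | "r < diam []" "diam [] \<le> R" | "R < diam []" by linarith
    then show ?thesis
    proof cases
      case 1
      have "dist x y \<le> r" if "y \<in> limit_set \<Gamma> E" for y
        using limit_set_subset x that by (intro order_trans[OF dist_le_diam[OF Nil_mem] 1]) auto
      moreover have "1 * 1 \<le> C * q powr - s"
        using C12 q_ge by (intro mult_mono) (auto simp: C_def)
      ultimately show ?thesis using x unfolding q_def by (intro exI[of _ "{x}"]) auto
    next
      case 2
      have ar: "0 < \<alpha> * r" using \<alpha> r by simp
      show ?thesis
      proof (rule from_words)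
        show "finite (large (\<alpha> * r) \<inter> cut_set \<Gamma> E r)" using large(1)[OF ar] by simp
        have "real (card (large (\<alpha> * r) \<inter> cut_set \<Gamma> E r)) \<le> real (card (large (\<alpha> * r)))"
          using large(1)[OF ar] by (simp add: card_mono)
        also have "\<dots> \<le> Q * (\<alpha> * r) powr - s" by (rule large(2)[OF ar])
        also have "(\<alpha> * r) powr - s = (\<alpha> * R) powr - s * q powr - s"
          unfolding powr_mult[symmetric] using r by (simp add: q_def)
        also have "Q * \<dots> \<le> Q * ((\<alpha> * diam []) powr - s * q powr - s)"
          using Q(1) \<alpha> t d0 2 by (intro mult_left_mono mult_right_mono powr_mono2') auto
        finally show "real (card (large (\<alpha> * r) \<inter> cut_set \<Gamma> E r)) \<le> C2 * q powr - s"
          by (simp add: C2_def mult.assoc)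
        show "\<exists>n. trunc n k \<in> large (\<alpha> * r) \<inter> cut_set \<Gamma> E r" if k: "k \<in> \<Gamma>" for k
        proof -
          obtain n where n: "trunc (Suc n) k \<in> cut_set \<Gamma> E r"
            using prefix_in_cut_set[OF k r(1) 2(1)] by blast
          then show ?thesis using cut_setD[OF n] by (auto simp: large_def intro!: exI[of _ "Suc n"])
        qed
      qed (use C12 in \<open>auto simp: C_def\<close>)
    next
      case 3
      have R: "0 < R" using r by simp
      define \<rho> where "\<rho> = \<alpha> / D * q"
      have \<rho>: "0 < \<rho>" using \<alpha> D q by (simp add: \<rho>_def)
      define P where "P = local_cut_set \<Gamma> E x R \<times> large \<rho>"
      define W where "W = (\<lambda>p. fst p @ snd p) ` P \<inter> cut_set \<Gamma> E r"
      have P: "finite P" using N[OF x R] large(1)[OF \<rho>] by (simp add: P_def)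
      show ?thesis
      proof (rule from_words)
        show "finite W" using P by (simp add: W_def)
        show "W \<subseteq> cut_set \<Gamma> E r" by (simp add: W_def)
        have "card W \<le> card P"
          unfolding W_def using P by (meson card_image_le card_mono finite_imageI inf_le1 order_trans)
        then have "real (card W) \<le> real (card (local_cut_set \<Gamma> E x R)) * real (card (large \<rho>))"
          unfolding P_def card_cartesian_product by (metis of_nat_le_iff of_nat_mult)
        also have "\<dots> \<le> real N * (Q * \<rho> powr - s)"
          using N[OF x R] large(2)[OF \<rho>] by (intro mult_mono) auto
        also have "\<dots> = C1 * q powr - s"
          unfolding \<rho>_def C1_def powr_mult by simp
        finally show "real (card W) \<le> C1 * q powr - s" .
        show "\<exists>n. trunc n k \<in> W" if k: "k \<in> \<Gamma>" and near: "moran_proj E k \<in> cball x R" for k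
        proof -
          obtain m where m: "trunc (Suc m) k \<in> cut_set \<Gamma> E R"
            using prefix_in_cut_set[OF k R 3] by blast
          obtain n where n: "trunc (Suc n) k \<in> cut_set \<Gamma> E r"
            using prefix_in_cut_set[OF k r(1)] r(2) 3 by auto
          have "m \<le> n"
          proof (rule ccontr)
            assume "\<not> m \<le> n"
            then have "diam (trunc m k) \<le> diam (trunc (Suc n) k)"
              by (intro diam_trunc_mono k) auto
            then show False using cut_setD(3)[OF n] cut_setD(4)[OF m] r(2) by simp
          qed
          define i where "i = trunc (Suc m) k"
          define j where "j = trunc (n - m) ((left_shift ^^ Suc m) k)"
          have ij: "trunc (Suc n) k = i @ j"
            using trunc_add[of "Suc m" "n - m" k] \<open>m \<le> n\<close> by (simp add: i_def j_def)
          have fw: "i @ j \<in> finite_words \<Gamma>" using cut_setD(1)[OF n] by (simp add: ij)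
          have j: "j \<in> finite_words \<Gamma>" by (rule finite_words_appendD(2)[OF shift fw])
          have "\<alpha> * r < diam (i @ j)" using cut_setD(5)[OF n] by (simp add: ij)
          also have "\<dots> \<le> D * diam i * diam j" by (rule diam_append[OF fw])
          also have "\<dots> \<le> D * R * diam j"
            using cut_setD(3)[OF m] D diam_pos[OF j] by (intro mult_right_mono mult_left_mono) (auto simp: i_def)
          finally have "\<rho> \<le> diam j"
            using D R by (simp add: \<rho>_def q_def field_simps)
          then have "j \<in> large \<rho>" using j by (simp add: large_def)
          moreover have "i \<in> local_cut_set \<Gamma> E x R"
            using m moran_proj_mem[OF k, of "Suc m"] near by (auto simp: local_cut_set_def i_def)
          ultimately have "(i, j) \<in> P" by (simp add: P_def)
          then have "trunc (Suc n) k \<in> W" using n ij by (force simp: W_def)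
          then show ?thesis by blast
        qed
      qed (use C12 in \<open>auto simp: C_def\<close>)
    qed
  qed
  have "1 \<le> C" using C12 by (simp add: C_def)
  with cover have "\<exists>C\<ge>1. \<forall>x\<in>limit_set \<Gamma> E. \<forall>r R. 0 < r \<and> r < R \<longrightarrow>
      (\<exists>F\<subseteq>limit_set \<Gamma> E. finite F \<and> real (card F) \<le> C * (r / R) powr - s \<and>
        limit_set \<Gamma> E \<inter> cball x R \<subseteq> (\<Union>y\<in>F. cball y r))"
    by (intro exI[of _ C] conjI ballI allI impI) simp_all
  moreover have "0 \<le> s" using t by simp
  ultimately show ?thesis
    unfolding assouad_dim_def by (intro Inf_lower) blast
qed


section \<open>The Hausdorff measure at the zero of the pressure is positive\<close>

text \<open>Otherwise \<open>sum_words_tendsto_0\<close>, applied to the weights \<open>(D * diam i) powr t\<close>, would make the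
  partition sums tend to \<open>0\<close>.\<close>

lemma prefix_cover_sum_ge_1:
  assumes "0 \<le> t"
    and lower: "\<And>n. 0 < n \<Longrightarrow> 1 \<le> D powr t * partition_sum t n"
    and F: "finite F" "[] \<notin> F" "\<And>k. k \<in> \<Gamma> \<Longrightarrow> \<exists>m. trunc m k \<in> F"
  shows "1 \<le> D powr t * (\<Sum>i\<in>F. diam i powr t)"
proof (rule ccontr)
  assume "\<not> 1 \<le> D powr t * (\<Sum>i\<in>F. diam i powr t)"
  then have lt1: "(\<Sum>i\<in>F. (D * diam i) powr t) < 1"
    by (simp add: powr_mult sum_distrib_left)
  have "(\<lambda>n. \<Sum>i\<in>words_of_length \<Gamma> n. (D * diam i) powr t) \<longlonglongrightarrow> 0"
    by (rule sum_words_tendsto_0[OF sub shift _ _ F lt1])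
      (use assms(1) in \<open>auto intro: powr_weight_append\<close>)
  then have "\<forall>\<^sub>F n in sequentially. D powr t * partition_sum t n < 1"
    unfolding sum_weight_eq by (rule order_tendstoD) simp
  moreover have "\<forall>\<^sub>F n in sequentially. \<not> D powr t * partition_sum t n < 1"
    using eventually_gt_at_top[of 0] by eventually_elim (simp add: lower not_less)
  ultimately have "\<forall>\<^sub>F n::nat in sequentially. False" by eventually_elim blast
  then show False by simp
qed

text \<open>Clustering translates covers by sets into covers by words: if \<open>U\<close> has diameter at most \<open>r\<close>
  and meets the limit set in \<open>x\<close>, the addresses of the points of \<open>U\<close> all have prefixes among the
  at most \<open>N\<close> words of \<open>local_cut_set \<Gamma> E x r\<close>, whose sets have diameter at most \<open>r\<close>.  By
  compactness, finitely many of the words so obtained from a cover still contain a prefix of every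
  element of \<open>\<Gamma>\<close>, and \<open>prefix_cover_sum_ge_1\<close> bounds their diameter sum from below.  The
  bound on \<open>\<delta>\<close> guarantees that prefixes of diameter about \<open>r\<close> exist.\<close>

lemma hausdorff_premeasure_ge:
  assumes t: "0 < t"
    and lower: "\<And>n. 0 < n \<Longrightarrow> 1 \<le> D powr t * partition_sum t n"
    and N: "0 < N" "\<And>x r. x \<in> limit_set \<Gamma> E \<Longrightarrow> 0 < r \<Longrightarrow>
      finite (local_cut_set \<Gamma> E x r) \<and> card (local_cut_set \<Gamma> E x r) \<le> N"
    and \<delta>: "\<delta> < diam []"
  shows "ennreal (D powr - t / real N) \<le> hausdorff_premeasure t \<delta> (limit_set \<Gamma> E)"
  unfolding hausdorff_premeasure_def
proof (rule INF_greatest, clarify)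
  fix U :: "nat \<Rightarrow> 'a set"
  assume cover: "limit_set \<Gamma> E \<subseteq> (\<Union>n. U n)"
    and U: "\<forall>n. bounded (U n) \<and> diameter (U n) \<le> \<delta>"
  define c where "c = D powr - t / real N"
  define g where "g n = diameter (U n) powr t" for n
  have gauge: "hausdorff_gauge t (U n) = ennreal (g n)" for n
    using t by (auto simp: hausdorff_gauge_def g_def diameter_def)
  show "ennreal c \<le> (\<Sum>n. hausdorff_gauge t (U n))"
  proof (rule ccontr)
    assume "\<not> ennreal c \<le> (\<Sum>n. hausdorff_gauge t (U n))"
    then have lt: "(\<Sum>n. ennreal (g n)) < ennreal c" by (simp add: gauge not_le)
    have g: "0 \<le> g n" for n by (simp add: g_def)
    have sg: "summable g"
      using lt g by (intro summable_suminf_not_top) (auto simp: top_unique dest: less_top[THEN iffD2])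
    have "ennreal (suminf g) < ennreal c"
      using lt suminf_ennreal2[OF g sg] by simp
    then have gc: "suminf g < c" using suminf_nonneg[OF sg g] by (simp add: ennreal_less_iff)
    define \<eta> where "\<eta> = (c - suminf g) / 2"
    have \<eta>: "0 < \<eta>" "suminf g + \<eta> < c" using gc by (auto simp: \<eta>_def field_simps)
    define e where "e n = \<eta> * (1/2) ^ Suc n" for n
    have e: "0 < e n" for n using \<eta> by (simp add: e_def)
    have e_sums: "e sums \<eta>"
      unfolding e_def using sums_mult[OF power_half_series, of \<eta>] by simp
    \<comment> \<open>A covering set may have diameter zero, so the radii are raised slightly.\<close>
    define r where "r n = max (diameter (U n)) (min (diam [] / 2) (e n powr (1 / t)))" for n
    have d0: "0 < diam []" by (rule diam_pos[OF Nil_mem])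
    have r: "0 < r n" "r n < diam []" "diameter (U n) \<le> r n" for n
      using d0 e[of n] U \<delta> by (auto simp: r_def less_max_iff_disj min_less_iff_disj intro: le_less_trans)
    have r_powr: "r n powr t \<le> g n + e n" for n
    proof (cases "r n = diameter (U n)")
      case True
      then show ?thesis using e[of n] by (simp add: g_def)
    next
      case False
      then have "r n \<le> e n powr (1 / t)" by (auto simp: r_def max_def min_def split: if_splits)
      then have "r n powr t \<le> (e n powr (1 / t)) powr t"
        using t r(1)[of n] by (intro powr_mono2) auto
      also have "\<dots> = e n" using t e[of n] by (simp add: powr_powr)
      finally show ?thesis using g[of n] by simp
    qed
    define x where "x n = (SOME y. y \<in> U n \<inter> limit_set \<Gamma> E)" for n
    have x: "x n \<in> U n \<inter> limit_set \<Gamma> E" if "U n \<inter> limit_set \<Gamma> E \<noteq> {}" for n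
      unfolding x_def by (rule someI_ex) (use that in blast)
    define F where "F n = (if U n \<inter> limit_set \<Gamma> E = {} then {} else local_cut_set \<Gamma> E (x n) (r n))" for n
    have F: "finite (F n)" "card (F n) \<le> N" for n
      using N(2)[of "x n" "r n"] x[of n] r(1)[of n] by (auto simp: F_def)
    have F_cut: "w \<in> cut_set \<Gamma> E (r n)" if "w \<in> F n" for w n
      using that by (auto simp: F_def local_cut_set_def split: if_splits)
    have "\<exists>m. trunc m k \<in> (\<Union>n. F n)" if k: "k \<in> \<Gamma>" for k
    proof -
      have kE: "moran_proj E k \<in> limit_set \<Gamma> E" using k by (auto simp: limit_set_def)
      then obtain n where n: "moran_proj E k \<in> U n" using cover by blast
      obtain m where m: "trunc (Suc m) k \<in> cut_set \<Gamma> E (r n)"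
        using prefix_in_cut_set[OF k r(1,2)] by blast
      have xn: "x n \<in> U n \<inter> limit_set \<Gamma> E" using n kE by (intro x) auto
      have "dist (x n) (moran_proj E k) \<le> r n"
        using diameter_bounded_bound[of "U n" "x n" "moran_proj E k"] U xn n r(3)[of n] by auto
      then have "trunc (Suc m) k \<in> F n"
        using m n kE moran_proj_mem[OF k, of "Suc m"] by (auto simp: F_def local_cut_set_def)
      then show ?thesis by blast
    qed
    then obtain F' where F': "finite F'" "F' \<subseteq> (\<Union>n. F n)" "\<And>k. k \<in> \<Gamma> \<Longrightarrow> \<exists>m. trunc m k \<in> F'"
      using finite_prefix_subcover[OF sub compact, of "\<Union>n. F n"] by metis
    have "[] \<notin> F'"
      using F'(2) F_cut cut_setD(2) by blast
    have "1 \<le> D powr t * (\<Sum>i\<in>F'. diam i powr t)"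
      by (rule prefix_cover_sum_ge_1[OF less_imp_le[OF t] lower F'(1) \<open>[] \<notin> F'\<close> F'(3)])
    also have "\<dots> < D powr t * (real N * c)"
    proof (intro mult_strict_left_mono)
      obtain h where h: "\<And>i. i \<in> F' \<Longrightarrow> i \<in> F (h i)" using F'(2) by (metis UN_E subsetD)
      define I where "I = h ` F'"
      have I: "finite I" using F'(1) by (simp add: I_def)
      have "F' \<subseteq> snd ` Sigma I F" using h by (force simp: I_def)
      then have "(\<Sum>i\<in>F'. diam i powr t) \<le> (\<Sum>i\<in>snd ` Sigma I F. diam i powr t)"
        using I F by (intro sum_mono2) auto
      also have "\<dots> \<le> (\<Sum>p\<in>Sigma I F. diam (snd p) powr t)"
        using I F sum_image_le[of "Sigma I F" "\<lambda>i. diam i powr t" snd] by (simp add: o_def)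
      also have "\<dots> = (\<Sum>n\<in>I. \<Sum>i\<in>F n. diam i powr t)"
        using I F by (simp add: sum.Sigma case_prod_unfold)
      also have "\<dots> \<le> (\<Sum>n\<in>I. real N * (g n + e n))"
      proof (rule sum_mono)
        fix n
        have "(\<Sum>i\<in>F n. diam i powr t) \<le> real (card (F n)) * r n powr t"
          using t cut_setD[OF F_cut] diam_pos
          by (intro sum_bounded_above powr_mono2) (auto intro: less_imp_le)
        also have "\<dots> \<le> real N * (g n + e n)"
          using F(2) r_powr by (intro mult_mono) auto
        finally show "(\<Sum>i\<in>F n. diam i powr t) \<le> real N * (g n + e n)" .
      qed
      also have "\<dots> = real N * (\<Sum>n\<in>I. g n + e n)" by (simp add: sum_distrib_left)
      also have "\<dots> \<le> real N * (suminf g + \<eta>)"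
      proof (rule mult_left_mono)
        have sums: "(\<lambda>n. g n + e n) sums (suminf g + \<eta>)"
          by (intro sums_add summable_sums sg e_sums)
        show "(\<Sum>n\<in>I. g n + e n) \<le> suminf g + \<eta>"
          unfolding sums_unique[OF sums]
          by (intro sum_le_suminf sums_summable[OF sums] I add_nonneg_nonneg g less_imp_le[OF e])
      qed simp
      also have "\<dots> < real N * c" using \<eta>(2) N(1) by simp
      finally show "(\<Sum>i\<in>F'. diam i powr t) < real N * c" .
      show "0 < D powr t" using D by simp
    qed
    also have "\<dots> = 1" using D N(1) by (simp add: c_def powr_minus)
    finally show False by simp
  qed
qed

lemma hausdorff_measure_pos:
  assumes t: "0 \<le> t"
    and lower: "\<And>n. 0 < n \<Longrightarrow> 1 \<le> D powr t * partition_sum t n"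
    and clustering: "uniform_finite_clustering \<Gamma> E"
  shows "0 < hausdorff_measure t (limit_set \<Gamma> E)"
proof -
  have d0: "0 < diam []" by (rule diam_pos[OF Nil_mem])
  have "0 < hausdorff_premeasure t (diam [] / 2) (limit_set \<Gamma> E)"
  proof (cases "t = 0")
    case True
    \<comment> \<open>For \<open>t = 0\<close> the gauge counts the non-empty covering sets.\<close>
    have "1 \<le> hausdorff_premeasure t (diam [] / 2) (limit_set \<Gamma> E)"
      unfolding hausdorff_premeasure_def
    proof (rule INF_greatest, clarify)
      fix U :: "nat \<Rightarrow> 'a set"
      assume "limit_set \<Gamma> E \<subseteq> (\<Union>n. U n)"
      moreover have "limit_set \<Gamma> E \<noteq> {}" using nonempty by (simp add: limit_set_def)
      ultimately obtain n where "U n \<noteq> {}" by blast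
      then have "1 = (\<Sum>m\<in>{n}. hausdorff_gauge t (U m))" using True by (simp add: hausdorff_gauge_def)
      also have "\<dots> \<le> (\<Sum>n. hausdorff_gauge t (U n))" by (intro sum_le_suminf) auto
      finally show "1 \<le> (\<Sum>n. hausdorff_gauge t (U n))" .
    qed
    then show ?thesis using zero_less_one order_less_le_trans by blast
  next
    case False
    obtain N where N: "\<And>x r. x \<in> limit_set \<Gamma> E \<Longrightarrow> 0 < r \<Longrightarrow>
        finite (local_cut_set \<Gamma> E x r) \<and> card (local_cut_set \<Gamma> E x r) \<le> N"
      using clustering unfolding uniform_finite_clustering_def by blast
    have "ennreal (D powr - t / real (Suc N)) \<le> hausdorff_premeasure t (diam [] / 2) (limit_set \<Gamma> E)"
      using False t d0 lower N by (intro hausdorff_premeasure_ge) (auto intro: le_SucI)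
    moreover have "0 < ennreal (D powr - t / real (Suc N))" using D by simp
    ultimately show ?thesis by (rule order_less_le_trans[rotated])
  qed
  also have "\<dots> \<le> hausdorff_measure t (limit_set \<Gamma> E)"
    unfolding hausdorff_measure_def using d0 by (intro SUP_upper) auto
  finally show ?thesis .
qed

end


section \<open>Dimensions of the limit set\<close>

theorem proposition3p5:
  fixes \<kappa> :: nat
    and \<Gamma> :: "word set"
    and E :: "nat list \<Rightarrow> 'a::complete_space set"
    and t :: real
  assumes "\<kappa> \<ge> 2"
    and "\<Gamma> \<subseteq> full_shift \<kappa>"
    and "compactin (Metric_space.mtopology (full_shift \<kappa>) word_dist) \<Gamma>"
    and "left_shift ` \<Gamma> \<subseteq> \<Gamma>"
    and "moran_construction \<Gamma> E"
    and "\<exists>D\<ge>1. \<forall>i j. i @ j \<in> finite_words \<Gamma> \<longrightarrow>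
           diameter (E (i @ j)) \<le> D * diameter (E i) * diameter (E j)"
    and "\<exists>\<alpha>. 0 < \<alpha> \<and> \<alpha> < 1 \<and>
           (\<forall>i \<in> finite_words \<Gamma> - {[]}. diameter (E i) \<ge> \<alpha> * diameter (E (butlast i)))"
    and "uniform_finite_clustering \<Gamma> E"
    and "t \<ge> 0"
    and "pressure \<Gamma> E t = 0"
  shows "ereal t = hausdorff_dim (limit_set \<Gamma> E) \<and>
         hausdorff_dim (limit_set \<Gamma> E) = assouad_dim (limit_set \<Gamma> E) \<and>
         hausdorff_measure t (limit_set \<Gamma> E) > 0"
proof -
  obtain D where D: "1 \<le> D" "\<And>i j. i @ j \<in> finite_words \<Gamma> \<Longrightarrow>
      diameter (E (i @ j)) \<le> D * diameter (E i) * diameter (E j)"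
    using assms(6) by blast
  obtain \<alpha> where \<alpha>: "0 < \<alpha>" "\<alpha> < 1" "\<And>i. i \<in> finite_words \<Gamma> \<Longrightarrow> i \<noteq> [] \<Longrightarrow>
      \<alpha> * diameter (E (butlast i)) \<le> diameter (E i)"
    using assms(7) by blast
  have nonempty: "\<Gamma> \<noteq> {}"
  proof
    assume "\<Gamma> = {}"
    then have sums: "(\<Sum>i\<in>words_of_length \<Gamma> n. diameter (E i) powr t) = 0" for n
      by (simp add: words_of_length_def)
    have "\<forall>\<^sub>F n in sequentially. - \<infinity> = ereal (1 / real n) * ext_log 0"
      using eventually_gt_at_top[of 0] by eventually_elim (simp add: ext_log_def)
    then have "(\<lambda>n. ereal (1 / real n) * ext_log 0) \<longlonglongrightarrow> - \<infinity>"
      by (rule tendsto_eventually[OF eventually_mono]) auto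
    then have "pressure \<Gamma> E t = - \<infinity>"
      unfolding pressure_def sums by (rule limI)
    with assms(10) show False by simp
  qed
  interpret moran_system \<kappa> \<Gamma> E D \<alpha>
    using assms(2-5) D \<alpha> nonempty by unfold_locales
  note bounds = partition_sum_bounds[OF assms(9,10)]
  have pos: "0 < hausdorff_measure t (limit_set \<Gamma> E)"
    using assms(8,9) bounds(1) by (intro hausdorff_measure_pos)
  have "assouad_dim (limit_set \<Gamma> E) \<le> ereal t"
  proof (rule ereal_le_epsilon2)
    fix \<epsilon> :: real assume "0 < \<epsilon>"
    then have "assouad_dim (limit_set \<Gamma> E) \<le> ereal (t + \<epsilon>)"
      using assms(8,9) bounds(2) by (intro assouad_dim_le[of t]) auto
    then show "assouad_dim (limit_set \<Gamma> E) \<le> ereal t + ereal \<epsilon>" by simp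
  qed
  moreover have "ereal t \<le> hausdorff_dim (limit_set \<Gamma> E)"
    by (rule le_hausdorff_dim[OF pos])
  moreover have "hausdorff_dim (limit_set \<Gamma> E) \<le> assouad_dim (limit_set \<Gamma> E)"
    using bounded_subset[OF bounded_E[OF Nil_mem] limit_set_subset]
    by (rule hausdorff_dim_le_assouad_dim)
  ultimately show ?thesis using pos by auto
qed

end
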